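(* Let $G$ be a finite group and let $m\geq 2$ be an integer. Then there exist a connected $C^{\infty}$ manifold $M$ of dimension $m$ and a vector field $X$ on $M$ such that $\pi_0(\operatorname{Aut}(X))\cong G$ (as groups).
   Context: Manifolds are real, $C^{\infty}$, paracompact and without boundary; vector fields are $C^{\infty}$. For a vector field $X$ on $M$, $\operatorname{Aut}(X)=\{f\in\operatorname{Diff}(M): f_*(X(p))=X(f(p))\text{ for all }p\in M\}$, a subgroup of the group $\operatorname{Diff}(M)$ of $C^\infty$ diffeomorphisms of $M$. It is regarded as a topological group with the topology induced from the (weak, i.e. compact-open) $C^\infty$ topology on $\operatorname{Diff}(M)$, and $\pi_0(\operatorname{Aut}(X))$ is its group of path components. *)

theory Defs
  imports "HOL-Analysis.Analysis" "HOL-Algebra.Bij"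
begin

section \<open>Smooth maps between open subsets of Euclidean spaces\<close>

text \<open>\<open>nderiv f [v\<^sub>1, \<dots>, v\<^sub>k] x\<close> is the value of the \<open>k\<close>-th derivative of \<open>f\<close> at \<open>x\<close> on the
  vectors \<open>v\<^sub>1, \<dots>, v\<^sub>k\<close>, obtained by iterating directional derivatives.\<close>

primrec nderiv ::
    "('a::euclidean_space \<Rightarrow> 'b::euclidean_space) \<Rightarrow> 'a list \<Rightarrow> 'a \<Rightarrow> 'b" where
  "nderiv f [] = f"
| "nderiv f (v # vs) = (\<lambda>x. frechet_derivative (nderiv f vs) (at x) v)"

text \<open>Only used for open \<open>S\<close>. Differentiability of the iterated derivatives of all orders also
  gives their continuity, so this is \<open>C\<^sup>\<infinity>\<close>.\<close>

definition smooth_on :: "'a::euclidean_space set \<Rightarrow> ('a \<Rightarrow> 'b::euclidean_space) \<Rightarrow> bool" where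
  "smooth_on S f \<longleftrightarrow> (\<forall>vs. \<forall>x\<in>S. nderiv f vs differentiable (at x))"

section \<open>Smooth manifolds\<close>

text \<open>A chart is a pair \<open>(U, \<phi>)\<close>; the values of \<open>\<phi>\<close> outside \<open>U\<close> are irrelevant.\<close>

type_synonym ('p, 'e) chart = "'p set \<times> ('p \<Rightarrow> 'e)"

record ('p, 'e) smooth_space =
  mtop :: "'p topology"
  matlas :: "('p, 'e) chart set"

abbreviation mpoints :: "('p, 'e, 'z) smooth_space_scheme \<Rightarrow> 'p set" where
  "mpoints M \<equiv> topspace (mtop M)"

definition is_chart :: "'p topology \<Rightarrow> ('p, 'e::euclidean_space) chart \<Rightarrow> bool" where
  "is_chart T c \<longleftrightarrow> openin T (fst c) \<and> open (snd c ` fst c) \<and>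
     homeomorphic_map (subtopology T (fst c)) (top_of_set (snd c ` fst c)) (snd c)"

text \<open>The expression \<open>\<psi> \<circ> f \<circ> \<phi>\<^sup>-\<^sup>1\<close> of \<open>f\<close> in the charts \<open>c = (U, \<phi>)\<close> and \<open>d = (V, \<psi>)\<close>;
  it is meaningful on \<open>\<phi> ` (U \<inter> f -` V)\<close>.\<close>

definition local_rep ::
    "('p \<Rightarrow> 'q) \<Rightarrow> ('p, 'e) chart \<Rightarrow> ('q, 'f) chart \<Rightarrow> 'e \<Rightarrow> 'f" where
  "local_rep f c d = snd d \<circ> f \<circ> inv_into (fst c) (snd c)"

definition compatible ::
    "('p, 'e::euclidean_space) chart \<Rightarrow> ('p, 'e) chart \<Rightarrow> bool" where
  "compatible c d \<longleftrightarrow>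
     smooth_on (snd c ` (fst c \<inter> fst d)) (local_rep (\<lambda>p. p) c d) \<and>
     smooth_on (snd d ` (fst c \<inter> fst d)) (local_rep (\<lambda>p. p) d c)"

definition paracompact_space :: "'p topology \<Rightarrow> bool" where
  "paracompact_space T \<longleftrightarrow>
     (\<forall>\<U>. (\<forall>U\<in>\<U>. openin T U) \<and> \<Union>\<U> = topspace T \<longrightarrow>
        (\<exists>\<V>. (\<forall>V\<in>\<V>. openin T V) \<and> \<Union>\<V> = topspace T \<and>
             (\<forall>V\<in>\<V>. \<exists>U\<in>\<U>. V \<subseteq> U) \<and> locally_finite_in T \<V>))"

text \<open>The atlas need not be maximal. The dimension is the dimension of the model space \<open>'e\<close>, and
  there is no boundary because the images of charts are open in \<open>'e\<close>.\<close>

definition smooth_manifold :: "('p, 'e::euclidean_space, 'z) smooth_space_scheme \<Rightarrow> bool" where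
  "smooth_manifold M \<longleftrightarrow>
     Hausdorff_space (mtop M) \<and> paracompact_space (mtop M) \<and>
     (\<forall>c\<in>matlas M. is_chart (mtop M) c) \<and>
     (\<Union>c\<in>matlas M. fst c) = mpoints M \<and>
     (\<forall>c\<in>matlas M. \<forall>d\<in>matlas M. compatible c d)"

text \<open>The maximal atlas.\<close>

definition charts ::
    "('p, 'e::euclidean_space, 'z) smooth_space_scheme \<Rightarrow> ('p, 'e) chart set" where
  "charts M = {c. is_chart (mtop M) c \<and> (\<forall>d\<in>matlas M. compatible c d)}"

definition charts_at ::
    "('p, 'e::euclidean_space, 'z) smooth_space_scheme \<Rightarrow> 'p \<Rightarrow> ('p, 'e) chart set" where
  "charts_at M p = {c \<in> charts M. p \<in> fst c}"

text \<open>Continuity makes the domains of the local expressions open.\<close>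

definition smooth_map ::
    "('p, 'e::euclidean_space, 'y) smooth_space_scheme \<Rightarrow>
     ('q, 'f::euclidean_space, 'z) smooth_space_scheme \<Rightarrow> ('p \<Rightarrow> 'q) \<Rightarrow> bool" where
  "smooth_map M N f \<longleftrightarrow> continuous_map (mtop M) (mtop N) f \<and>
     (\<forall>c\<in>charts M. \<forall>d\<in>charts N.
        smooth_on (snd c ` (fst c \<inter> f -` fst d)) (local_rep f c d))"

section \<open>Tangent vectors and vector fields\<close>

text \<open>A tangent vector at \<open>p\<close> is an equivalence class of pairs \<open>(c, u)\<close>, where \<open>c\<close> is a chart
  around \<open>p\<close> and \<open>u\<close> is the coordinate vector in that chart; coordinate vectors are identified by
  the derivatives of the coordinate changes.\<close>

definition tangent_rel ::
    "('p, 'e::euclidean_space, 'z) smooth_space_scheme \<Rightarrow> 'p \<Rightarrow>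
     ((('p, 'e) chart \<times> 'e) \<times> (('p, 'e) chart \<times> 'e)) set" where
  "tangent_rel M p = {((c, u), (d, w)). c \<in> charts_at M p \<and> d \<in> charts_at M p \<and>
     w = frechet_derivative (local_rep (\<lambda>q. q) c d) (at (snd c p)) u}"

definition tangent_space ::
    "('p, 'e::euclidean_space, 'z) smooth_space_scheme \<Rightarrow> 'p \<Rightarrow>
     (('p, 'e) chart \<times> 'e) set set" where
  "tangent_space M p = (charts_at M p \<times> UNIV) // tangent_rel M p"

text \<open>The tangent map \<open>f\<^sub>* : T\<^sub>p M \<rightarrow> T\<^sub>f\<^sub>(\<^sub>p\<^sub>) N\<close>. All representatives of \<open>v\<close> contribute the same
  set of pairs.\<close>

definition tangent_map ::
    "('p, 'e::euclidean_space, 'y) smooth_space_scheme \<Rightarrow>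
     ('q, 'f::euclidean_space, 'z) smooth_space_scheme \<Rightarrow> ('p \<Rightarrow> 'q) \<Rightarrow> 'p \<Rightarrow>
     (('p, 'e) chart \<times> 'e) set \<Rightarrow> (('q, 'f) chart \<times> 'f) set" where
  "tangent_map M N f p v =
     (\<Union>(c, u)\<in>v. {(d, frechet_derivative (local_rep f c d) (at (snd c p)) u) | d.
        d \<in> charts_at N (f p)})"

definition smooth_vector_field ::
    "('p, 'e::euclidean_space, 'z) smooth_space_scheme \<Rightarrow>
     ('p \<Rightarrow> (('p, 'e) chart \<times> 'e) set) \<Rightarrow> bool" where
  "smooth_vector_field M X \<longleftrightarrow> (\<forall>p\<in>mpoints M. X p \<in> tangent_space M p) \<and>
     (\<forall>c\<in>charts M. \<exists>\<xi>. smooth_on (snd c ` fst c) \<xi> \<and>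
        (\<forall>p\<in>fst c. (c, \<xi> (snd c p)) \<in> X p))"

section \<open>Diffeomorphisms and automorphisms of a vector field\<close>

text \<open>As in \<^term>\<open>BijGroup\<close>, self-maps of a manifold are extensional functions, so that equality of
  maps is equality in HOL.\<close>

definition diffeos :: "('p, 'e::euclidean_space, 'z) smooth_space_scheme \<Rightarrow> ('p \<Rightarrow> 'p) set" where
  "diffeos M = {f \<in> Bij (mpoints M).
     smooth_map M M f \<and> smooth_map M M (\<lambda>p\<in>mpoints M. inv_into (mpoints M) f p)}"

definition vf_auts ::
    "('p, 'e::euclidean_space, 'z) smooth_space_scheme \<Rightarrow>
     ('p \<Rightarrow> (('p, 'e) chart \<times> 'e) set) \<Rightarrow> ('p \<Rightarrow> 'p) set" where
  "vf_auts M X = {f \<in> diffeos M. \<forall>p\<in>mpoints M. tangent_map M M f p (X p) = X (f p)}"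

definition Aut_group ::
    "('p, 'e::euclidean_space, 'z) smooth_space_scheme \<Rightarrow>
     ('p \<Rightarrow> (('p, 'e) chart \<times> 'e) set) \<Rightarrow> ('p \<Rightarrow> 'p) monoid" where
  "Aut_group M X = (BijGroup (mpoints M))\<lparr>carrier := vf_auts M X\<rparr>"

section \<open>The weak topology on spaces of smooth maps\<close>

definition smooth_maps ::
    "('p, 'e::euclidean_space, 'y) smooth_space_scheme \<Rightarrow>
     ('q, 'f::euclidean_space, 'z) smooth_space_scheme \<Rightarrow> ('p \<Rightarrow> 'q) set" where
  "smooth_maps M N = {f \<in> extensional (mpoints M). smooth_map M N f}"

text \<open>The maps that send the compact set \<open>K\<close> into the domain of \<open>d\<close> and whose local expression in
  the charts \<open>c\<close> and \<open>d\<close> is \<open>\<epsilon>\<close>-close to that of \<open>f\<close> on the image of \<open>K\<close>, together with all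
  derivatives of order at most \<open>r\<close>. Since \<open>\<epsilon>\<close> bounds the values on all vectors of norm at most 1,
  the derivatives are compared as multilinear maps in the operator norm.\<close>

definition weak_nbhd ::
    "('p, 'e::euclidean_space, 'y) smooth_space_scheme \<Rightarrow>
     ('q, 'f::euclidean_space, 'z) smooth_space_scheme \<Rightarrow> ('p \<Rightarrow> 'q) \<Rightarrow>
     ('p, 'e) chart \<Rightarrow> ('q, 'f) chart \<Rightarrow> 'p set \<Rightarrow> nat \<Rightarrow> real \<Rightarrow> ('p \<Rightarrow> 'q) set" where
  "weak_nbhd M N f c d K r \<epsilon> = {g \<in> smooth_maps M N. g ` K \<subseteq> fst d \<and>
     (\<forall>x\<in>snd c ` K. \<forall>vs. length vs \<le> r \<and> set vs \<subseteq> cball 0 1 \<longrightarrow>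
        norm (nderiv (local_rep f c d) vs x - nderiv (local_rep g c d) vs x) < \<epsilon>)}"

definition weak_topology ::
    "('p, 'e::euclidean_space, 'y) smooth_space_scheme \<Rightarrow>
     ('q, 'f::euclidean_space, 'z) smooth_space_scheme \<Rightarrow> ('p \<Rightarrow> 'q) topology" where
  "weak_topology M N = topology_generated_by
     {weak_nbhd M N f c d K r \<epsilon> | f c d K r \<epsilon>.
        f \<in> smooth_maps M N \<and> c \<in> charts M \<and> d \<in> charts N \<and>
        compactin (mtop M) K \<and> K \<subseteq> fst c \<and> f ` K \<subseteq> fst d \<and> 0 < \<epsilon>}"

definition Aut_topology ::
    "('p, 'e::euclidean_space, 'z) smooth_space_scheme \<Rightarrow>
     ('p \<Rightarrow> (('p, 'e) chart \<times> 'e) set) \<Rightarrow> ('p \<Rightarrow> 'p) topology" where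
  "Aut_topology M X = subtopology (subtopology (weak_topology M M) (diffeos M)) (vf_auts M X)"

section \<open>The group of path components\<close>

text \<open>For a group \<open>G\<close> with a group topology \<open>T\<close> on its carrier. The product of two path components
  is the path component of \<open>x \<otimes> y\<close>, for \<open>x\<close> and \<open>y\<close> in the factors; the members of the union all
  coincide because multiplication is continuous.\<close>

definition pi0_group :: "('a, 'b) monoid_scheme \<Rightarrow> 'a topology \<Rightarrow> 'a set monoid" where
  "pi0_group G T =
     \<lparr>carrier = path_components_of T,
      mult = \<lambda>C D. \<Union>x\<in>C. \<Union>y\<in>D. path_component_of_set T (x \<otimes>\<^bsub>G\<^esub> y),
      one = path_component_of_set T \<one>\<^bsub>G\<^esub>\<rparr>"

definition pi0_Aut ::
    "('p, 'e::euclidean_space, 'z) smooth_space_scheme \<Rightarrow>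
     ('p \<Rightarrow> (('p, 'e) chart \<times> 'e) set) \<Rightarrow> ('p \<Rightarrow> 'p) set monoid" where
  "pi0_Aut M X = pi0_group (Aut_group M X) (Aut_topology M X)"

text \<open>Manifolds whose existence is asserted have their points in the following type. Connected
  paracompact manifolds have at most continuum many points, so every such manifold has a copy with
  points in this type. The topology is part of the manifold, not inherited from the type.\<close>

type_synonym point = "nat \<Rightarrow> real"

end

theory Submission
  imports Defs
begin

text \<open>Let \<open>a\<close>, \<open>b\<close> be two orthonormal vectors of the model space. The manifold is a Galois covering with
  group \<open>G\<close> of an open set \<open>P\<close> of Euclidean space, and the vector field is the lift of the constant
  field \<open>a\<close>. The set \<open>P\<close> consists of the two open half spaces bounded by \<open>b\<^sup>\<bottom>\<close>, joined by one window
  for each element of \<open>G\<close>, minus the points \<open>y n \<plusminus> n a\<close>, \<open>n \<ge> 1\<close>, where the \<open>y n\<close> are distinct and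
  dense in \<open>a\<^sup>\<bottom>\<close>. Passing the window of \<open>k\<close> multiplies the sheet by \<open>k\<close>.

  Automorphisms preserve the life times of points along the incomplete flow. The segment between
  \<open>y n - n a\<close> and \<open>y n + n a\<close> is the only leaf of \<open>P\<close> of length \<open>2n\<close>, so an automorphism covers the
  identity over these segments. They are dense, so it covers the identity everywhere and is a deck
  transformation. Hence \<open>Aut(X)\<close> is \<open>G\<close>, acting by left multiplication, with the discrete topology.\<close>

section \<open>Calculus of smooth maps\<close>

text \<open>The obstacle is that the \<open>y n\<close> have to be dense, to control an automorphism
  everywhere, while the removed set has to be closed. The heights \<open>n\<close> and
  \<open>- n\<close> settle both: the pairs escape to infinity, and the length \<open>2n\<close> of
  a segment reveals its index. Windows have length 1, so the leaves inside the hyperplane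
  \<open>b \<bullet> x = 0\<close> are too short to be mistaken for a segment. The
  \<open>y n\<close> avoid that hyperplane, so each segment fits into a single sheet. No flow is
  constructed: life times are replaced by the fact that a map preserving the field moves projections
  with velocity \<open>a\<close> along lines of direction \<open>a\<close>. Labels are multiplied on
  the right at the windows, so left multiplication respects the gluing also for nonabelian
  \<open>G\<close>.\<close>

lemma nderiv_append: "nderiv f (vs @ ws) = nderiv (nderiv f ws) vs"
  by (induction vs) auto

lemma frechet_derivative_cong_open:
  assumes "open S" "x \<in> S" "\<And>y. y \<in> S \<Longrightarrow> f y = g y"
  shows "frechet_derivative f (at x) = frechet_derivative g (at x)"
proof -
  have "(f has_derivative D) (at x) \<longleftrightarrow> (g has_derivative D) (at x)" for D
    using assms by (metis has_derivative_transform_within_open)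
  then show ?thesis by (simp add: frechet_derivative_def)
qed

lemma differentiable_cong_open:
  assumes "open S" "x \<in> S" "\<And>y. y \<in> S \<Longrightarrow> f y = g y"
  shows "f differentiable (at x) \<longleftrightarrow> g differentiable (at x)"
proof -
  have "(f has_derivative D) (at x) \<longleftrightarrow> (g has_derivative D) (at x)" for D
    using assms by (metis has_derivative_transform_within_open)
  then show ?thesis by (simp add: differentiable_def)
qed

lemma nderiv_cong_open:
  assumes "open S" "\<And>y. y \<in> S \<Longrightarrow> f y = g y"
  shows "x \<in> S \<Longrightarrow> nderiv f vs x = nderiv g vs x"
proof (induction vs arbitrary: x)
  case (Cons v vs)
  then show ?case
    using frechet_derivative_cong_open[OF assms(1) Cons.prems, of "nderiv f vs" "nderiv g vs"] by simp
qed (use assms in auto)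

lemma smooth_on_cong:
  assumes "open S" "\<And>y. y \<in> S \<Longrightarrow> f y = g y"
  shows "smooth_on S f \<longleftrightarrow> smooth_on S g"
proof -
  have "nderiv f vs differentiable (at x) \<longleftrightarrow> nderiv g vs differentiable (at x)"
    if "x \<in> S" for vs x
    using nderiv_cong_open[OF assms] by (intro differentiable_cong_open[OF assms(1) that])
  then show ?thesis by (simp add: smooth_on_def)
qed

lemma smooth_on_subset: "smooth_on S f \<Longrightarrow> T \<subseteq> S \<Longrightarrow> smooth_on T f"
  by (auto simp: smooth_on_def)

lemma smooth_on_differentiable: "smooth_on S f \<Longrightarrow> x \<in> S \<Longrightarrow> f differentiable (at x)"
  unfolding smooth_on_def by (metis nderiv.simps(1))

lemma smooth_on_nderiv: "smooth_on S f \<Longrightarrow> smooth_on S (nderiv f ws)"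
  unfolding smooth_on_def by (metis nderiv_append)

text \<open>Finite orders make induction possible: the derivative of a product or of a composition
  is built from the given functions and their first derivatives, all of which are available to the
  next lower order.\<close>

definition smooth_upto :: "nat \<Rightarrow> 'a::euclidean_space set \<Rightarrow> ('a \<Rightarrow> 'b::euclidean_space) \<Rightarrow> bool" where
  "smooth_upto k S f \<longleftrightarrow> (\<forall>vs. length vs \<le> k \<longrightarrow> (\<forall>x\<in>S. nderiv f vs differentiable (at x)))"

lemma smooth_on_iff_upto: "smooth_on S f \<longleftrightarrow> (\<forall>k. smooth_upto k S f)"
  unfolding smooth_on_def smooth_upto_def by blast

lemma smooth_upto_0: "smooth_upto 0 S f \<longleftrightarrow> (\<forall>x\<in>S. f differentiable (at x))"
  by (simp add: smooth_upto_def)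

text \<open>In \<open>nderiv\<close> the last vector of the list is differentiated first, so the
  first derivative is split off at the end of the list. The product and chain rules are then applied
  once per induction step.\<close>

lemma smooth_upto_Suc:
  "smooth_upto (Suc k) S f \<longleftrightarrow>
     (\<forall>x\<in>S. f differentiable (at x)) \<and>
     (\<forall>v. smooth_upto k S (\<lambda>x. frechet_derivative f (at x) v))" (is "?L \<longleftrightarrow> ?R")
proof
  assume L: ?L
  have "nderiv (\<lambda>x. frechet_derivative f (at x) v) vs differentiable (at x)"
    if "length vs \<le> k" "x \<in> S" for v vs x
  proof -
    have "nderiv f (vs @ [v]) differentiable (at x)"
      using L that unfolding smooth_upto_def by fastforce
    then show ?thesis by (simp add: nderiv_append)
  qed
  moreover have "f differentiable (at x)" if "x \<in> S" for x
    using L that unfolding smooth_upto_def by (metis le0 list.size(3) nderiv.simps(1))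
  ultimately show ?R by (auto simp: smooth_upto_def)
next
  assume R: ?R
  have "nderiv f vs differentiable (at x)" if "length vs \<le> Suc k" "x \<in> S" for vs x
  proof (cases vs rule: rev_cases)
    case Nil
    then show ?thesis using R that by simp
  next
    case (snoc ws w)
    then show ?thesis using R that by (auto simp: smooth_upto_def nderiv_append)
  qed
  then show ?L by (auto simp: smooth_upto_def)
qed

lemma smooth_upto_differentiable:
  "smooth_upto k S f \<Longrightarrow> x \<in> S \<Longrightarrow> f differentiable (at x)"
  by (cases k) (auto simp: smooth_upto_0 smooth_upto_Suc)

lemma smooth_upto_SucD: "smooth_upto (Suc k) S f \<Longrightarrow> smooth_upto k S f"
  by (auto simp: smooth_upto_def)

lemma smooth_upto_cong:
  assumes "open S" "\<And>y. y \<in> S \<Longrightarrow> f y = g y" "smooth_upto k S g"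
  shows "smooth_upto k S f"
proof -
  have "nderiv f vs differentiable (at x) \<longleftrightarrow> nderiv g vs differentiable (at x)"
    if "x \<in> S" for vs x
    using nderiv_cong_open[OF assms(1,2)] by (intro differentiable_cong_open[OF assms(1) that])
  then show ?thesis using assms(3) by (simp add: smooth_upto_def)
qed

lemma smooth_upto_const: "smooth_upto k S (\<lambda>x. c)"
proof (induction k arbitrary: c)
  case (Suc k)
  have "frechet_derivative (\<lambda>x. c) (at x) = (\<lambda>v. 0)" for x
    by (metis frechet_derivative_at has_derivative_const)
  then show ?case using Suc by (simp add: smooth_upto_Suc)
qed (simp add: smooth_upto_0)

lemma smooth_upto_add:
  assumes "open S"
  shows "smooth_upto k S f \<Longrightarrow> smooth_upto k S g \<Longrightarrow> smooth_upto k S (\<lambda>x. f x + g x)"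
proof (induction k arbitrary: f g)
  case 0
  then show ?case by (auto simp: smooth_upto_0)
next
  case (Suc k)
  have d: "f differentiable (at x)" "g differentiable (at x)" if "x \<in> S" for x
    using Suc.prems that smooth_upto_differentiable by blast+
  have "smooth_upto k S (\<lambda>x. frechet_derivative (\<lambda>x. f x + g x) (at x) v)" for v
  proof (rule smooth_upto_cong[OF assms])
    show "frechet_derivative (\<lambda>x. f x + g x) (at y) v =
        frechet_derivative f (at y) v + frechet_derivative g (at y) v" if "y \<in> S" for y
    proof -
      have "((\<lambda>x. f x + g x) has_derivative
          (\<lambda>v. frechet_derivative f (at y) v + frechet_derivative g (at y) v)) (at y)"
        using d[OF that] by (intro has_derivative_add) (auto simp: frechet_derivative_works)
      from fun_cong[OF frechet_derivative_at[OF this], of v] show ?thesis by (rule sym)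
    qed
    show "smooth_upto k S (\<lambda>y. frechet_derivative f (at y) v + frechet_derivative g (at y) v)"
      using Suc.prems by (intro Suc.IH) (simp_all add: smooth_upto_Suc)
  qed
  then show ?case using d by (simp add: smooth_upto_Suc)
qed

lemma smooth_upto_sum:
  assumes "open S" "finite A" "\<And>i. i \<in> A \<Longrightarrow> smooth_upto k S (f i)"
  shows "smooth_upto k S (\<lambda>x. \<Sum>i\<in>A. f i x)"
  using assms(2,3)
proof (induction A)
  case empty
  show ?case by (simp add: smooth_upto_const)
next
  case (insert i A)
  have "smooth_upto k S (\<lambda>x. f i x + (\<Sum>i\<in>A. f i x))"
    using insert by (intro smooth_upto_add[OF assms(1)]) auto
  then show ?case using insert.hyps by simp
qed

lemma smooth_upto_inner:
  assumes "open S"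
  shows "smooth_upto k S f \<Longrightarrow> smooth_upto k S (\<lambda>x. f x \<bullet> c)"
proof (induction k arbitrary: f)
  case 0
  then show ?case by (auto simp: smooth_upto_0)
next
  case (Suc k)
  have d: "f differentiable (at x)" if "x \<in> S" for x
    using Suc.prems that smooth_upto_differentiable by blast+
  have "smooth_upto k S (\<lambda>x. frechet_derivative (\<lambda>x. f x \<bullet> c) (at x) v)" for v
  proof (rule smooth_upto_cong[OF assms])
    show "frechet_derivative (\<lambda>x. f x \<bullet> c) (at y) v = frechet_derivative f (at y) v \<bullet> c"
      if "y \<in> S" for y
    proof -
      have "((\<lambda>x. f x \<bullet> c) has_derivative (\<lambda>v. frechet_derivative f (at y) v \<bullet> c)) (at y)"
        using d[OF that] by (auto intro!: derivative_eq_intros simp: frechet_derivative_works)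
      from fun_cong[OF frechet_derivative_at[OF this], of v] show ?thesis by (rule sym)
    qed
    show "smooth_upto k S (\<lambda>y. frechet_derivative f (at y) v \<bullet> c)"
      using Suc.prems by (intro Suc.IH) (simp_all add: smooth_upto_Suc)
  qed
  then show ?case using d by (simp add: smooth_upto_Suc)
qed

lemma smooth_upto_scaleR:
  assumes "open S"
  shows "smooth_upto k S f \<Longrightarrow> smooth_upto k S g \<Longrightarrow> smooth_upto k S (\<lambda>x. f x *\<^sub>R g x)"
proof (induction k arbitrary: f g)
  case 0
  then show ?case by (auto simp: smooth_upto_0)
next
  case (Suc k)
  have d: "f differentiable (at x)" "g differentiable (at x)" if "x \<in> S" for x
    using Suc.prems that smooth_upto_differentiable by blast+
  have "smooth_upto k S (\<lambda>x. frechet_derivative (\<lambda>x. f x *\<^sub>R g x) (at x) v)" for v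
  proof (rule smooth_upto_cong[OF assms])
    show "frechet_derivative (\<lambda>x. f x *\<^sub>R g x) (at y) v =
        f y *\<^sub>R frechet_derivative g (at y) v + frechet_derivative f (at y) v *\<^sub>R g y"
      if "y \<in> S" for y
    proof -
      have "((\<lambda>x. f x *\<^sub>R g x) has_derivative
          (\<lambda>v. f y *\<^sub>R frechet_derivative g (at y) v + frechet_derivative f (at y) v *\<^sub>R g y)) (at y)"
        using d[OF that] by (intro has_derivative_scaleR) (auto simp: frechet_derivative_works)
      from fun_cong[OF frechet_derivative_at[OF this], of v] show ?thesis by (rule sym)
    qed
    show "smooth_upto k S
        (\<lambda>y. f y *\<^sub>R frechet_derivative g (at y) v + frechet_derivative f (at y) v *\<^sub>R g y)"
      using Suc.prems
      by (intro smooth_upto_add[OF assms] Suc.IH) (simp_all add: smooth_upto_Suc smooth_upto_SucD)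
  qed
  then show ?case using d by (simp add: smooth_upto_Suc)
qed

text \<open>The chain rule yields a linear map depending on \<open>f y\<close>, applied to a vector
  depending on \<open>y\<close>. Expanding the vector in \<open>Basis\<close> gives a finite sum of
  scalar functions times partial derivatives of \<open>g\<close> composed with \<open>f\<close>, to
  which the induction hypothesis and the product rule apply.\<close>

lemma smooth_upto_compose:
  fixes f :: "'a::euclidean_space \<Rightarrow> 'b::euclidean_space" and g :: "'b \<Rightarrow> 'c::euclidean_space"
  assumes "open S" "open T" "f ` S \<subseteq> T"
  shows "smooth_upto k S f \<Longrightarrow> smooth_upto k T g \<Longrightarrow> smooth_upto k S (\<lambda>x. g (f x))"
proof (induction k arbitrary: g)
  case 0
  then show ?case
    using assms differentiable_chain_at[of f _ g] by (auto simp: smooth_upto_0 o_def)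
next
  case (Suc k)
  have df: "f differentiable (at x)" and dg: "g differentiable (at (f x))" if "x \<in> S" for x
    using Suc.prems that assms smooth_upto_differentiable by blast+
  have d: "(\<lambda>x. g (f x)) differentiable (at x)" if "x \<in> S" for x
    using differentiable_chain_at[OF df dg] that by (simp add: o_def)
  have "smooth_upto k S (\<lambda>x. frechet_derivative (\<lambda>x. g (f x)) (at x) v)" for v
  proof (rule smooth_upto_cong[OF assms(1)])
    show "frechet_derivative (\<lambda>x. g (f x)) (at y) v =
        (\<Sum>c\<in>Basis. (frechet_derivative f (at y) v \<bullet> c) *\<^sub>R frechet_derivative g (at (f y)) c)"
      if "y \<in> S" for y
    proof -
      have lin: "linear (frechet_derivative g (at (f y)))"
        using dg[OF that] linear_frechet_derivative by blast
      have "frechet_derivative (\<lambda>x. g (f x)) (at y) v =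
          frechet_derivative g (at (f y)) (frechet_derivative f (at y) v)"
        using frechet_derivative_compose[OF df dg] that by (simp add: o_def)
      also have "\<dots> = frechet_derivative g (at (f y))
          (\<Sum>c\<in>Basis. (frechet_derivative f (at y) v \<bullet> c) *\<^sub>R c)"
        by (simp add: euclidean_representation)
      also have "\<dots> = (\<Sum>c\<in>Basis. (frechet_derivative f (at y) v \<bullet> c) *\<^sub>R frechet_derivative g (at (f y)) c)"
        using lin by (simp add: linear_sum linear_scale)
      finally show ?thesis .
    qed
    show "smooth_upto k S
        (\<lambda>y. \<Sum>c\<in>Basis. (frechet_derivative f (at y) v \<bullet> c) *\<^sub>R frechet_derivative g (at (f y)) c)"
      using Suc.prems Suc.IH[of "\<lambda>z. frechet_derivative g (at z) c" for c]
      by (intro smooth_upto_sum smooth_upto_scaleR smooth_upto_inner assms(1) finite_Basis)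
        (simp_all add: smooth_upto_Suc smooth_upto_SucD)
  qed
  then show ?case using d by (simp add: smooth_upto_Suc)
qed

lemma smooth_on_compose:
  assumes "open S" "open T" "f ` S \<subseteq> T" "smooth_on S f" "smooth_on T g"
  shows "smooth_on S (g \<circ> f)"
proof -
  have "smooth_upto k S f" "smooth_upto k T g" for k
    using assms(4,5) by (auto simp: smooth_on_def smooth_upto_def)
  then have "smooth_upto k S (\<lambda>x. g (f x))" for k
    by (rule smooth_upto_compose[OF assms(1-3), of k g])
  then show ?thesis
    unfolding smooth_on_iff_upto o_def by blast
qed

lemma smooth_on_ident: "smooth_on S (\<lambda>x. x)"
proof -
  have "smooth_upto k S (\<lambda>x. x)" for k
  proof (cases k)
    case (Suc l)
    have "frechet_derivative (\<lambda>x. x) (at x) = (\<lambda>v. v)" for x :: 'a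
      by (metis frechet_derivative_at has_derivative_ident)
    then show ?thesis using Suc by (simp add: smooth_upto_Suc smooth_upto_const)
  qed (simp add: smooth_upto_0)
  then show ?thesis by (simp add: smooth_on_iff_upto)
qed

section \<open>Local expressions and charts\<close>

lemma is_chart_subset: "is_chart T c \<Longrightarrow> fst c \<subseteq> topspace T"
  by (simp add: is_chart_def openin_subset)

lemma is_chart_inj: "is_chart T c \<Longrightarrow> inj_on (snd c) (fst c)"
  using homeomorphic_imp_injective_map[of "subtopology T (fst c)"] is_chart_subset[of T c]
  by (auto simp: is_chart_def Int_absorb1)

lemma is_chart_open_image:
  assumes "is_chart T c" "openin T W" "W \<subseteq> fst c"
  shows "open (snd c ` W)"
proof -
  have "openin (subtopology T (fst c)) W"
    using assms by (metis openin_subtopology_Int Int_absorb2)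
  then have "openin (top_of_set (snd c ` fst c)) (snd c ` W)"
    using assms(1) homeomorphic_imp_open_map open_map_def unfolding is_chart_def by blast
  then show ?thesis
    using assms(1) by (auto simp: is_chart_def elim: openin_open_trans)
qed

lemma local_rep_apply:
  "inj_on (snd c) (fst c) \<Longrightarrow> p \<in> fst c \<Longrightarrow> local_rep f c d (snd c p) = snd d (f p)"
  by (simp add: local_rep_def)

lemma openin_chart_domain:
  assumes "continuous_map T T' f" "is_chart T c" "is_chart T' d"
  shows "openin T (fst c \<inter> f -` fst d)"
proof -
  have "openin T (fst c \<inter> {x \<in> topspace T. f x \<in> fst d})"
    using assms by (intro openin_Int openin_continuous_map_preimage) (auto simp: is_chart_def)
  moreover have "fst c \<inter> {x \<in> topspace T. f x \<in> fst d} = fst c \<inter> f -` fst d"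
    using is_chart_subset[OF assms(2)] by auto
  ultimately show ?thesis by simp
qed

lemma open_rep_domain:
  assumes "continuous_map T T' f" "is_chart T c" "is_chart T' d"
  shows "open (snd c ` (fst c \<inter> f -` fst d))"
  using is_chart_open_image[OF assms(2) openin_chart_domain[OF assms]] by simp

lemma open_rep_domain2:
  assumes "continuous_map T T' f" "continuous_map T' T'' g"
    "is_chart T c" "is_chart T' d" "is_chart T'' e"
  shows "open (snd c ` (fst c \<inter> f -` fst d \<inter> (g \<circ> f) -` fst e))"
proof -
  have "openin T ((fst c \<inter> f -` fst d) \<inter> (fst c \<inter> (g \<circ> f) -` fst e))"
    using assms by (intro openin_Int openin_chart_domain continuous_map_compose) auto
  then show ?thesis
    by (intro is_chart_open_image[OF assms(3)]) (auto simp: Int_ac)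
qed

text \<open>The middle chart \<open>d\<close> cancels only over points that \<open>f\<close> sends
  into its domain, hence the triple intersection.\<close>

lemma smooth_on_local_rep_comp:
  fixes c :: "('p, 'e::euclidean_space) chart" and d :: "('q, 'f::euclidean_space) chart"
    and e :: "('r, 'h::euclidean_space) chart"
  assumes "continuous_map T T' f" "continuous_map T' T'' g"
    and c: "is_chart T c" and d: "is_chart T' d" and e: "is_chart T'' e"
    and f: "smooth_on (snd c ` (fst c \<inter> f -` fst d)) (local_rep f c d)"
    and g: "smooth_on (snd d ` (fst d \<inter> g -` fst e)) (local_rep g d e)"
  shows "smooth_on (snd c ` (fst c \<inter> f -` fst d \<inter> (g \<circ> f) -` fst e)) (local_rep (g \<circ> f) c e)"
    (is "smooth_on ?O _")
proof -
  have O: "open ?O" by (rule open_rep_domain2[OF assms(1-5)])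
  have c_apply: "local_rep f c d (snd c p) = snd d (f p)" if "p \<in> fst c" for p
    using local_rep_apply[OF is_chart_inj[OF c] that] .
  have "smooth_on ?O (local_rep g d e \<circ> local_rep f c d)"
  proof (rule smooth_on_compose[OF O open_rep_domain[OF assms(2) d e]])
    show "local_rep f c d ` ?O \<subseteq> snd d ` (fst d \<inter> g -` fst e)"
      using c_apply by auto
    show "smooth_on ?O (local_rep f c d)"
      by (rule smooth_on_subset[OF f]) auto
  qed (rule g)
  then show ?thesis
    by (subst smooth_on_cong[OF O]) (auto simp: local_rep_apply is_chart_inj[OF c] is_chart_inj[OF d])
qed

lemma frechet_derivative_local_rep_comp:
  fixes c :: "('p, 'e::euclidean_space) chart" and d :: "('q, 'f::euclidean_space) chart"
    and e :: "('r, 'h::euclidean_space) chart"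
  assumes "continuous_map T T' f" "continuous_map T' T'' g"
    and c: "is_chart T c" and d: "is_chart T' d" and e: "is_chart T'' e"
    and f: "smooth_on (snd c ` (fst c \<inter> f -` fst d)) (local_rep f c d)"
    and g: "smooth_on (snd d ` (fst d \<inter> g -` fst e)) (local_rep g d e)"
    and p: "p \<in> fst c" "f p \<in> fst d" "g (f p) \<in> fst e"
  shows "frechet_derivative (local_rep (g \<circ> f) c e) (at (snd c p)) u =
    frechet_derivative (local_rep g d e) (at (snd d (f p)))
      (frechet_derivative (local_rep f c d) (at (snd c p)) u)"
proof -
  let ?O = "snd c ` (fst c \<inter> f -` fst d \<inter> (g \<circ> f) -` fst e)"
  have O: "open ?O" by (rule open_rep_domain2[OF assms(1-5)])
  have "frechet_derivative (local_rep (g \<circ> f) c e) (at (snd c p)) =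
      frechet_derivative (local_rep g d e \<circ> local_rep f c d) (at (snd c p))"
    using p by (intro frechet_derivative_cong_open[OF O])
      (auto simp: local_rep_apply is_chart_inj[OF c] is_chart_inj[OF d])
  moreover have "frechet_derivative (local_rep g d e \<circ> local_rep f c d) (at (snd c p)) =
      frechet_derivative (local_rep g d e) (at (local_rep f c d (snd c p))) \<circ>
      frechet_derivative (local_rep f c d) (at (snd c p))"
    using p local_rep_apply[OF is_chart_inj[OF c] p(1), of f d]
    by (intro frechet_derivative_compose smooth_on_differentiable[OF f] smooth_on_differentiable[OF g]) auto
  ultimately show ?thesis
    using local_rep_apply[OF is_chart_inj[OF c] p(1), of f d] by simp
qed

section \<open>Working with the maximal atlas\<close>

lemma charts_is_chart: "c \<in> charts M \<Longrightarrow> is_chart (mtop M) c"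
  by (simp add: charts_def)

lemma matlas_subset_charts: "smooth_manifold M \<Longrightarrow> matlas M \<subseteq> charts M"
  by (auto simp: smooth_manifold_def charts_def)

lemma smooth_manifold_cover:
  "smooth_manifold M \<Longrightarrow> p \<in> mpoints M \<Longrightarrow> \<exists>c\<in>matlas M. p \<in> fst c"
  unfolding smooth_manifold_def by blast

text \<open>Charts of the maximal atlas are related to each other only through atlas charts; near
  each common point such a chart \<open>k\<close> is inserted between them.\<close>

lemma charts_compatible:
  assumes M: "smooth_manifold M" and c: "c \<in> charts M" and d: "d \<in> charts M"
  shows "smooth_on (snd c ` (fst c \<inter> fst d)) (local_rep (\<lambda>p. p) c d)"
proof -
  have id: "continuous_map (mtop M) (mtop M) (\<lambda>p. p)" by simp
  \<comment> \<open>\<open>smooth_on\<close> is a pointwise condition, and the iterated derivatives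
    at a point already look at a neighbourhood of it. So singletons suffice, and \<open>k\<close>
    may depend on \<open>p\<close>.\<close>
  have "smooth_on {snd c p} (local_rep (\<lambda>p. p) c d)" if p: "p \<in> fst c" "p \<in> fst d" for p
  proof -
    have "p \<in> mpoints M"
      using is_chart_subset[OF charts_is_chart[OF c]] p by auto
    then obtain k where k: "k \<in> matlas M" "p \<in> fst k"
      using smooth_manifold_cover[OF M] by blast
    have "compatible c k" "compatible d k" using c d k by (auto simp: charts_def)
    then have "smooth_on (snd c ` (fst c \<inter> (\<lambda>p. p) -` fst k)) (local_rep (\<lambda>p. p) c k)"
      "smooth_on (snd k ` (fst k \<inter> (\<lambda>p. p) -` fst d)) (local_rep (\<lambda>p. p) k d)"
      by (auto simp: compatible_def Int_commute)
    from smooth_on_local_rep_comp[OF id id _ _ _ this]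
    have "smooth_on (snd c ` (fst c \<inter> fst k \<inter> fst d)) (local_rep (\<lambda>p. p) c d)"
      using c d k matlas_subset_charts[OF M] by (simp add: o_def charts_is_chart subsetD)
    then show ?thesis
      by (rule smooth_on_subset) (use p k in auto)
  qed
  then show ?thesis by (auto simp: smooth_on_def)
qed

text \<open>Coordinate changes inserted on both sides carry smoothness from one pair of charts
  around a point to every other pair. This reduces the quantification over both maximal atlases to
  the sheet charts.\<close>

lemma smooth_mapI:
  assumes M: "smooth_manifold M" and N: "smooth_manifold N"
    and f: "continuous_map (mtop M) (mtop N) f"
    and loc: "\<And>p. p \<in> mpoints M \<Longrightarrow> \<exists>c\<in>charts M. \<exists>d\<in>charts N. p \<in> fst c \<and> f p \<in> fst d \<and>
      smooth_on (snd c ` (fst c \<inter> f -` fst d)) (local_rep f c d)"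
  shows "smooth_map M N f"
  unfolding smooth_map_def
proof (intro conjI ballI)
  fix c d assume c: "c \<in> charts M" and d: "d \<in> charts N"
  have "smooth_on {snd c p} (local_rep f c d)" if p: "p \<in> fst c" "f p \<in> fst d" for p
  proof -
    have "p \<in> mpoints M"
      using is_chart_subset[OF charts_is_chart[OF c]] p by auto
    then obtain c' d' where c': "c' \<in> charts M" "p \<in> fst c'" and d': "d' \<in> charts N" "f p \<in> fst d'"
      and s: "smooth_on (snd c' ` (fst c' \<inter> f -` fst d')) (local_rep f c' d')"
      using loc by blast
    have sc: "smooth_on (snd c ` (fst c \<inter> (\<lambda>p. p) -` fst c')) (local_rep (\<lambda>p. p) c c')"
      using charts_compatible[OF M c c'(1)] by simp
    have sd: "smooth_on (snd d' ` (fst d' \<inter> (\<lambda>p. p) -` fst d)) (local_rep (\<lambda>p. p) d' d)"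
      using charts_compatible[OF N d'(1) d] by simp
    note ch = charts_is_chart[OF c] charts_is_chart[OF c'(1)] charts_is_chart[OF d]
      charts_is_chart[OF d'(1)]
    have cd': "smooth_on (snd c ` (fst c \<inter> fst c' \<inter> f -` fst d')) (local_rep f c d')"
      using smooth_on_local_rep_comp[OF _ f ch(1,2,4) sc s] by (simp add: o_def)
    let ?O = "snd c ` (fst c \<inter> fst c' \<inter> f -` fst d' \<inter> f -` fst d)"
    have O: "open ?O"
    proof (rule is_chart_open_image[OF ch(1)])
      have "openin (mtop M) ((fst c \<inter> f -` fst d') \<inter> (fst c \<inter> f -` fst d) \<inter> fst c')"
        using f ch by (intro openin_Int openin_chart_domain) (auto simp: is_chart_def)
      then show "openin (mtop M) (fst c \<inter> fst c' \<inter> f -` fst d' \<inter> f -` fst d)"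
        by (rule back_subst[of "openin (mtop M)"]) auto
    qed auto
    have inj: "inj_on (snd c) (fst c)" "inj_on (snd d') (fst d')"
      using ch by (auto intro: is_chart_inj)
    have "smooth_on ?O (local_rep (\<lambda>p. p) d' d \<circ> local_rep f c d')"
    proof (rule smooth_on_compose[OF O open_rep_domain[OF _ ch(4,3)]])
      show "continuous_map (mtop N) (mtop N) (\<lambda>p. p)" by simp
      show "local_rep f c d' ` ?O \<subseteq> snd d' ` (fst d' \<inter> (\<lambda>p. p) -` fst d)"
        using inj by (auto simp: local_rep_apply)
      show "smooth_on ?O (local_rep f c d')"
        by (rule smooth_on_subset[OF cd']) auto
    qed (rule sd)
    then have "smooth_on ?O (local_rep f c d)"
      by (subst smooth_on_cong[OF O]) (auto simp: local_rep_apply inj)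
    then show ?thesis
      by (rule smooth_on_subset) (use p c' d' in auto)
  qed
  then show "smooth_on (snd c ` (fst c \<inter> f -` fst d)) (local_rep f c d)"
    by (auto simp: smooth_on_def)
qed (rule f)

lemma smooth_mapD:
  assumes "smooth_map M N f" "c \<in> charts M" "d \<in> charts N"
  shows "smooth_on (snd c ` (fst c \<inter> f -` fst d)) (local_rep f c d)"
  using assms by (auto simp: smooth_map_def)

section \<open>Manifolds spread over a Euclidean space\<close>

text \<open>A manifold glued from open sets \<open>V i\<close>; all charts are restrictions of one projection \<open>pr\<close> with
  the sections \<open>s i\<close> as inverses, so that the coordinate changes are identities. The last two
  conditions on the overlaps give the Hausdorff property and even covering, which yields
  paracompactness.\<close>

locale sheets =
  fixes I :: "'i set" and V :: "'i \<Rightarrow> 'e::euclidean_space set"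
    and s :: "'i \<Rightarrow> 'e \<Rightarrow> 'p" and pr :: "'p \<Rightarrow> 'e"
  assumes finite_I: "finite I"
    and open_V: "i \<in> I \<Longrightarrow> open (V i)"
    and pr_s [simp]: "i \<in> I \<Longrightarrow> x \<in> V i \<Longrightarrow> pr (s i x) = x"
    and open_agree: "i \<in> I \<Longrightarrow> k \<in> I \<Longrightarrow> open {x \<in> V i \<inter> V k. s i x = s k x}"
    and open_disagree: "i \<in> I \<Longrightarrow> k \<in> I \<Longrightarrow> open {x \<in> V i \<inter> V k. s i x \<noteq> s k x}"
    and evenly: "i \<in> I \<Longrightarrow> k \<in> I \<Longrightarrow> x \<in> V i \<Longrightarrow> x \<in> V k \<Longrightarrow>
      \<exists>j\<in>I. V j = V i \<and> s j x = s k x"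
begin

section \<open>The topology glued from the sections\<close>

definition U :: "'i \<Rightarrow> 'p set" where "U i = s i ` V i"

text \<open>This is the final topology: the finest one on the union of the sheets for which all
  sections are continuous.\<close>

definition T :: "'p topology" where
  "T = topology (\<lambda>W. W \<subseteq> (\<Union>i\<in>I. U i) \<and> (\<forall>i\<in>I. open {x \<in> V i. s i x \<in> W}))"

definition ch :: "'i \<Rightarrow> ('p, 'e) chart" where "ch i = (U i, pr)"

definition M :: "('p, 'e) smooth_space" where "M = \<lparr>mtop = T, matlas = ch ` I\<rparr>"

lemma openin_T:
  "openin T W \<longleftrightarrow> W \<subseteq> (\<Union>i\<in>I. U i) \<and> (\<forall>i\<in>I. open {x \<in> V i. s i x \<in> W})"
proof -
  have "istopology (\<lambda>W. W \<subseteq> (\<Union>i\<in>I. U i) \<and> (\<forall>i\<in>I. open {x \<in> V i. s i x \<in> W}))"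
    unfolding istopology_def
  proof (intro conjI allI impI)
    fix A B assume "A \<subseteq> (\<Union>i\<in>I. U i) \<and> (\<forall>i\<in>I. open {x \<in> V i. s i x \<in> A})"
      "B \<subseteq> (\<Union>i\<in>I. U i) \<and> (\<forall>i\<in>I. open {x \<in> V i. s i x \<in> B})"
    moreover have "{x \<in> V i. s i x \<in> A \<inter> B} = {x \<in> V i. s i x \<in> A} \<inter> {x \<in> V i. s i x \<in> B}" for i
      by auto
    ultimately show "A \<inter> B \<subseteq> (\<Union>i\<in>I. U i)" "\<forall>i\<in>I. open {x \<in> V i. s i x \<in> A \<inter> B}"
      by auto
  next
    fix \<K> assume K: "\<forall>K\<in>\<K>. K \<subseteq> (\<Union>i\<in>I. U i) \<and> (\<forall>i\<in>I. open {x \<in> V i. s i x \<in> K})"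
    have "{x \<in> V i. s i x \<in> \<Union>\<K>} = (\<Union>K\<in>\<K>. {x \<in> V i. s i x \<in> K})" for i by auto
    then show "\<Union>\<K> \<subseteq> (\<Union>i\<in>I. U i)" "\<forall>i\<in>I. open {x \<in> V i. s i x \<in> \<Union>\<K>}"
      using K by auto
  qed
  then show ?thesis by (simp add: T_def)
qed

text \<open>The preimage of a piece of one sheet under another section is the part of the piece on
  which the two sections agree, which is open by \<open>open_agree\<close>.\<close>

lemma openin_image_sheet:
  assumes "i \<in> I" "open W" "W \<subseteq> V i"
  shows "openin T (s i ` W)"
proof -
  have "open {x \<in> V k. s k x \<in> s i ` W}" if k: "k \<in> I" for k
  proof -
    have "{x \<in> V k. s k x \<in> s i ` W} = {x \<in> V i \<inter> V k. s i x = s k x} \<inter> W"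
    proof (intro equalityI subsetI)
      fix x assume x: "x \<in> {x \<in> V k. s k x \<in> s i ` W}"
      then obtain y where y: "y \<in> W" "s k x = s i y" by blast
      then have "x = y" using assms k x by (metis (lifting) mem_Collect_eq pr_s subsetD)
      then show "x \<in> {x \<in> V i \<inter> V k. s i x = s k x} \<inter> W" using assms x y by auto
    qed (use assms in \<open>auto simp: image_iff intro: rev_bexI\<close>)
    then show ?thesis using open_agree[OF assms(1) k] assms(2) by auto
  qed
  then show ?thesis using assms by (auto simp: openin_T U_def)
qed

lemma openin_U: "i \<in> I \<Longrightarrow> openin T (U i)"
  by (simp add: U_def openin_image_sheet open_V)

lemma topspace_T: "topspace T = (\<Union>i\<in>I. U i)"
  using openin_U by (auto simp: openin_T topspace_def)

lemma U_cover: "p \<in> topspace T \<Longrightarrow> \<exists>i\<in>I. p \<in> U i"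
  by (simp add: topspace_T)

lemma s_pr [simp]: "i \<in> I \<Longrightarrow> p \<in> U i \<Longrightarrow> s i (pr p) = p"
  by (auto simp: U_def)

lemma pr_in_V [simp]: "i \<in> I \<Longrightarrow> p \<in> U i \<Longrightarrow> pr p \<in> V i"
  by (auto simp: U_def)

lemma s_in_U [simp]: "x \<in> V i \<Longrightarrow> s i x \<in> U i"
  by (auto simp: U_def)

lemma pr_image_U: "i \<in> I \<Longrightarrow> pr ` U i = V i"
  by (force simp: U_def)

lemma inj_on_pr: "i \<in> I \<Longrightarrow> inj_on pr (U i)"
  by (metis inj_onI s_pr)

lemma continuous_map_pr: "continuous_map T euclidean pr"
  unfolding continuous_map_def
proof (intro conjI allI impI)
  fix O' :: "'e set" assume "openin euclidean O'"
  then have O': "open O'" by simp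
  have "{x \<in> V i. s i x \<in> {p \<in> topspace T. pr p \<in> O'}} = V i \<inter> O'" if "i \<in> I" for i
    using that s_in_U by (fastforce simp: topspace_T)
  then show "openin T {p \<in> topspace T. pr p \<in> O'}"
    using O' open_V by (auto simp: openin_T topspace_T)
qed auto

lemma continuous_map_s: "i \<in> I \<Longrightarrow> continuous_map (top_of_set (V i)) T (s i)"
  by (auto simp: continuous_map_def topspace_T openin_T open_openin_trans open_V)

lemma continuous_map_from_T:
  assumes "\<And>i. i \<in> I \<Longrightarrow> continuous_map (top_of_set (V i)) Y (f \<circ> s i)"
  shows "continuous_map T Y f"
  unfolding continuous_map_def
proof (intro conjI allI impI)
  show "f \<in> topspace T \<rightarrow> topspace Y"
    using assms by (fastforce simp: topspace_T U_def continuous_map_def)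
  fix W assume W: "openin Y W"
  have "open {x \<in> V i. s i x \<in> {p \<in> topspace T. f p \<in> W}}" if i: "i \<in> I" for i
  proof -
    have "openin (top_of_set (V i)) {x \<in> V i. f (s i x) \<in> W}"
      using assms[OF i] W unfolding continuous_map_def by auto
    moreover have "{x \<in> V i. s i x \<in> {p \<in> topspace T. f p \<in> W}} = {x \<in> V i. f (s i x) \<in> W}"
      using i s_in_U by (fastforce simp: topspace_T)
    ultimately show ?thesis using open_V[OF i] by (metis openin_open_trans)
  qed
  then show "openin T {p \<in> topspace T. f p \<in> W}"
    by (auto simp: openin_T topspace_T)
qed

text \<open>Points with different projections are separated in the base. Over the same base point
  the two sheets are restricted to the open set where they disagree; a common point of the images
  would have a single projection, and the sections would agree there.\<close>

lemma Hausdorff_T: "Hausdorff_space T"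
  unfolding Hausdorff_space_def
proof (intro allI impI, elim conjE)
  fix p q assume p: "p \<in> topspace T" and q: "q \<in> topspace T" and "p \<noteq> q"
  obtain i k where i: "i \<in> I" "p \<in> U i" and k: "k \<in> I" "q \<in> U k"
    using U_cover p q by blast
  show "\<exists>A B. openin T A \<and> openin T B \<and> p \<in> A \<and> q \<in> B \<and> disjnt A B"
  proof (cases "pr p = pr q")
    case True
    let ?W = "{x \<in> V i \<inter> V k. s i x \<noteq> s k x}"
    have "openin T (s i ` ?W)" "openin T (s k ` ?W)"
      using open_disagree i k by (auto intro: openin_image_sheet)
    moreover have "pr p \<in> ?W"
      using True i k \<open>p \<noteq> q\<close> by auto (metis pr_in_V, metis s_pr)
    then have "p \<in> s i ` ?W" "q \<in> s k ` ?W"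
      using True i k by (metis (lifting) image_eqI s_pr)+
    moreover have "disjnt (s i ` ?W) (s k ` ?W)"
      using i k by (auto simp: disjnt_def) (metis pr_s)
    ultimately show ?thesis by blast
  next
    case False
    then obtain A B where AB: "open A" "open B" "pr p \<in> A" "pr q \<in> B" "A \<inter> B = {}"
      using hausdorff by metis
    have "openin T {x \<in> topspace T. pr x \<in> A}" "openin T {x \<in> topspace T. pr x \<in> B}"
      using AB by (auto intro!: openin_continuous_map_preimage[OF continuous_map_pr])
    moreover have "disjnt {x \<in> topspace T. pr x \<in> A} {x \<in> topspace T. pr x \<in> B}"
      using AB by (auto simp: disjnt_def)
    ultimately show ?thesis using AB p q by blast
  qed
qed

text \<open>Paracompactness is lifted from the base. \<open>\<C>\<close> collects the base sets that
  all sheets over one \<open>V i\<close> carry into members of the given cover. The lifts of a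
  locally finite refinement stay locally finite because there are finitely many sheets.\<close>

lemma paracompact_T: "paracompact_space T"
  unfolding paracompact_space_def
proof (intro allI impI, elim conjE)
  fix \<U> assume op: "\<forall>W\<in>\<U>. openin T W" and cov: "\<Union>\<U> = topspace T"
  define \<C> where "\<C> = {N. open N \<and> (\<exists>i\<in>I. N \<subseteq> V i \<and>
      (\<forall>j\<in>I. V j = V i \<longrightarrow> (\<exists>W\<in>\<U>. s j ` N \<subseteq> W)))}"
  have "x \<in> \<Union>\<C>" if i: "i \<in> I" and x: "x \<in> V i" for x i
  proof -
    let ?J = "{j \<in> I. V j = V i}"
    have "\<forall>j\<in>?J. \<exists>W. W \<in> \<U> \<and> s j x \<in> W"
    proof
      fix j assume "j \<in> ?J"
      then have "s j x \<in> topspace T"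
        using x s_in_U[of x j] unfolding topspace_T by blast
      then show "\<exists>W. W \<in> \<U> \<and> s j x \<in> W" unfolding cov[symmetric] by blast
    qed
    from bchoice[OF this] obtain W where W: "\<forall>j\<in>?J. W j \<in> \<U> \<and> s j x \<in> W j"
      by (elim exE)
    let ?N = "\<Inter>j\<in>?J. {y \<in> V j. s j y \<in> W j}"
    have "open {y \<in> V j. s j y \<in> W j}" if "j \<in> ?J" for j
    proof -
      have "openin T (W j)" using W op that by blast
      then show ?thesis using that unfolding openin_T by blast
    qed
    then have "open ?N"
      using finite_I by (intro open_INT) auto
    moreover have "?N \<subseteq> V i" using i by auto
    moreover have "\<forall>j\<in>I. V j = V i \<longrightarrow> (\<exists>W\<in>\<U>. s j ` ?N \<subseteq> W)"
    proof (intro ballI impI)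
      fix j assume "j \<in> I" "V j = V i"
      then have "W j \<in> \<U>" "s j ` ?N \<subseteq> W j" using W by auto
      then show "\<exists>W\<in>\<U>. s j ` ?N \<subseteq> W" by blast
    qed
    ultimately have "?N \<in> \<C>" using i unfolding \<C>_def by blast
    moreover have "x \<in> ?N" using x W by auto
    ultimately show ?thesis by blast
  qed
  then have "(\<Union>i\<in>I. V i) \<subseteq> \<Union>\<C>" by blast
  then obtain \<D> where D: "(\<Union>i\<in>I. V i) \<subseteq> \<Union>\<D>"
    and D_open: "\<And>N. N \<in> \<D> \<Longrightarrow> open N \<and> (\<exists>N'. N' \<in> \<C> \<and> N \<subseteq> N')"
    and D_fin: "\<And>x. x \<in> (\<Union>i\<in>I. V i) \<Longrightarrow> \<exists>O'. open O' \<and> x \<in> O' \<and> finite {N. N \<in> \<D> \<and> N \<inter> O' \<noteq> {}}"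
    by (rule paracompact) (auto simp: \<C>_def)
  define \<V> where "\<V> = {s j ` N | j N. j \<in> I \<and> N \<in> \<D> \<and> N \<subseteq> V j \<and> (\<exists>W\<in>\<U>. s j ` N \<subseteq> W)}"
  have V_open: "\<forall>W\<in>\<V>. openin T W"
    using D_open by (auto simp: \<V>_def intro: openin_image_sheet)
  moreover have V_cov: "\<Union>\<V> = topspace T"
  proof
    show "\<Union>\<V> \<subseteq> topspace T" using V_open by (auto dest: openin_subset)
    show "topspace T \<subseteq> \<Union>\<V>"
    proof
      fix p assume "p \<in> topspace T"
      then obtain k where k: "k \<in> I" "p \<in> U k" using U_cover by blast
      then have "pr p \<in> \<Union>\<D>" using D pr_in_V by blast
      then obtain N where N: "N \<in> \<D>" "pr p \<in> N" by (elim UnionE)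
      then obtain N' where "N' \<in> \<C>" "N \<subseteq> N'" using D_open by blast
      then obtain i where i: "i \<in> I" "N' \<subseteq> V i"
        and iN: "\<forall>j\<in>I. V j = V i \<longrightarrow> (\<exists>W\<in>\<U>. s j ` N' \<subseteq> W)"
        unfolding \<C>_def by blast
      \<comment> \<open>\<open>N\<close> is known to be small only for sheets over
        \<open>V i\<close>; \<open>evenly\<close> replaces the sheet \<open>k\<close> through
        \<open>p\<close> by one of these.\<close>
      obtain j where j: "j \<in> I" "V j = V i" "s j (pr p) = p"
        using evenly[OF i(1) k(1), of "pr p"] i N k \<open>N \<subseteq> N'\<close> by auto
      moreover obtain W where "W \<in> \<U>" "s j ` N' \<subseteq> W" using iN j by blast
      ultimately have "s j ` N \<in> \<V>"
        unfolding \<V>_def using N(1) i(2) \<open>N \<subseteq> N'\<close> by (intro CollectI exI[of _ j] exI[of _ N]) blast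
      moreover have "p \<in> s j ` N" using j N by (metis image_eqI)
      ultimately show "p \<in> \<Union>\<V>" by blast
    qed
  qed
  moreover have "\<forall>W\<in>\<V>. \<exists>W'\<in>\<U>. W \<subseteq> W'" by (auto simp: \<V>_def)
  moreover have "locally_finite_in T \<V>"
    unfolding locally_finite_in_def
  proof (intro conjI ballI)
    show "\<Union>\<V> \<subseteq> topspace T" using V_cov by simp
    fix p assume p: "p \<in> topspace T"
    then have "pr p \<in> (\<Union>i\<in>I. V i)" using U_cover pr_in_V by blast
    then obtain O' where O': "open O'" "pr p \<in> O'" "finite {N. N \<in> \<D> \<and> N \<inter> O' \<noteq> {}}"
      using D_fin by blast
    let ?W = "{q \<in> topspace T. pr q \<in> O'}"
    have "openin T ?W"
      using O' by (auto intro!: openin_continuous_map_preimage[OF continuous_map_pr])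
    moreover have "p \<in> ?W" using p O' by simp
    moreover have "{W \<in> \<V>. W \<inter> ?W \<noteq> {}} \<subseteq>
        (\<lambda>(j, N). s j ` N) ` (I \<times> {N. N \<in> \<D> \<and> N \<inter> O' \<noteq> {}})"
    proof
      fix W assume "W \<in> {W \<in> \<V>. W \<inter> ?W \<noteq> {}}"
      then obtain j N x where jN: "j \<in> I" "N \<in> \<D>" "N \<subseteq> V j" "W = s j ` N" "x \<in> N" "pr (s j x) \<in> O'"
        unfolding \<V>_def by auto
      then have "x \<in> N \<inter> O'" by (metis IntI pr_s subsetD)
      then show "W \<in> (\<lambda>(j, N). s j ` N) ` (I \<times> {N. N \<in> \<D> \<and> N \<inter> O' \<noteq> {}})"
        using jN by auto
    qed
    then have "finite {W \<in> \<V>. W \<inter> ?W \<noteq> {}}"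
      by (rule finite_subset) (use finite_I O'(3) in simp)
    ultimately show "\<exists>W. openin T W \<and> p \<in> W \<and> finite {A \<in> \<V>. A \<inter> W \<noteq> {}}" by blast
  qed
  ultimately show "\<exists>\<V>. (\<forall>W\<in>\<V>. openin T W) \<and> \<Union>\<V> = topspace T \<and>
      (\<forall>W\<in>\<V>. \<exists>W'\<in>\<U>. W \<subseteq> W') \<and> locally_finite_in T \<V>" by blast
qed

lemma is_chart_ch:
  assumes i: "i \<in> I"
  shows "is_chart T (ch i)"
proof -
  have "homeomorphic_maps (subtopology T (U i)) (top_of_set (V i)) pr (s i)"
    unfolding homeomorphic_maps_def
    using continuous_map_s[OF i] continuous_map_from_subtopology[OF continuous_map_pr] i
    by (auto simp: continuous_map_in_subtopology)
  then show ?thesis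
    using i by (auto simp: is_chart_def ch_def openin_U pr_image_U open_V homeomorphic_map_maps)
qed

lemma local_rep_ch: "i \<in> I \<Longrightarrow> x \<in> V i \<Longrightarrow> local_rep f (ch i) d x = snd d (f (s i x))"
  using local_rep_apply[of "ch i" "s i x" f d] by (simp add: ch_def inj_on_pr)

lemma compatible_ch:
  assumes "i \<in> I" "k \<in> I"
  shows "compatible (ch i) (ch k)"
proof -
  have *: "smooth_on (pr ` (U i \<inter> U k)) (local_rep (\<lambda>p. p) (ch i) (ch k))"
    if "i \<in> I" "k \<in> I" for i k
  proof (subst smooth_on_cong)
    have "is_chart T (ch i)" "openin T (U i \<inter> U k)"
      using that by (auto simp: openin_U is_chart_ch)
    then show "open (pr ` (U i \<inter> U k))"
      using is_chart_open_image[of T "ch i"] by (auto simp: ch_def)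
  next
    fix y assume "y \<in> pr ` (U i \<inter> U k)"
    then have "y \<in> V i" using that by auto
    then show "local_rep (\<lambda>p. p) (ch i) (ch k) y = y"
      using that by (simp add: local_rep_ch) (simp add: ch_def)
  qed (rule smooth_on_ident)
  from *[OF assms] *[OF assms(2,1)] show ?thesis
    unfolding compatible_def by (simp add: ch_def Int_commute)
qed

lemma smooth_manifold_M: "smooth_manifold M"
  using Hausdorff_T paracompact_T
  by (auto simp: smooth_manifold_def M_def is_chart_ch compatible_ch topspace_T) (auto simp: ch_def)

lemma mtop_M [simp]: "mtop M = T"
  by (simp add: M_def)

lemma ch_charts: "i \<in> I \<Longrightarrow> ch i \<in> charts M"
  using matlas_subset_charts[OF smooth_manifold_M] by (auto simp: M_def)

end

section \<open>The lift of a constant vector field\<close>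

context sheets
begin

text \<open>A tangent vector is a whole equivalence class, so its coordinates in all charts of the
  maximal atlas are listed. The choice of \<open>i\<close> does not matter: sections that meet at a
  point agree near it.\<close>

definition const_field :: "'e \<Rightarrow> 'p \<Rightarrow> (('p, 'e) chart \<times> 'e) set" where
  "const_field a p = {(c, u). c \<in> charts_at M p \<and>
     (\<exists>i\<in>I. p \<in> U i \<and> u = frechet_derivative (local_rep (\<lambda>q. q) (ch i) c) (at (pr p)) a)}"

lemma fst_ch [simp]: "fst (ch i) = U i" and snd_ch [simp]: "snd (ch i) = pr"
  by (simp_all add: ch_def)

lemma open_ch_domain:
  assumes "i \<in> I" "c \<in> charts M" "continuous_map T T f"
  shows "open (pr ` (U i \<inter> f -` fst c))"
  using open_rep_domain[OF assms(3) is_chart_ch[OF assms(1)]] charts_is_chart[OF assms(2)] by simp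

lemma ch_charts_at: "i \<in> I \<Longrightarrow> p \<in> U i \<Longrightarrow> ch i \<in> charts_at M p"
  by (simp add: charts_at_def ch_charts)

lemma frechet_derivative_ch_indep:
  assumes i: "i \<in> I" "p \<in> U i" and k: "k \<in> I" "p \<in> U k"
  shows "frechet_derivative (local_rep f (ch i) c) (at (pr p)) =
    frechet_derivative (local_rep f (ch k) c) (at (pr p))"
proof (rule frechet_derivative_cong_open[OF open_agree[OF i(1) k(1)]])
  show "pr p \<in> {x \<in> V i \<inter> V k. s i x = s k x}" using i k by simp
  show "local_rep f (ch i) c y = local_rep f (ch k) c y"
    if "y \<in> {x \<in> V i \<inter> V k. s i x = s k x}" for y
    using that i k by (simp add: local_rep_ch)
qed

lemma in_const_field_iff:
  assumes "i \<in> I" "p \<in> U i"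
  shows "(c, u) \<in> const_field a p \<longleftrightarrow> c \<in> charts_at M p \<and>
    u = frechet_derivative (local_rep (\<lambda>q. q) (ch i) c) (at (pr p)) a"
proof
  assume "(c, u) \<in> const_field a p"
  then obtain j where "j \<in> I" "p \<in> U j" "c \<in> charts_at M p"
    "u = frechet_derivative (local_rep (\<lambda>q. q) (ch j) c) (at (pr p)) a"
    unfolding const_field_def by blast
  then show "c \<in> charts_at M p \<and> u = frechet_derivative (local_rep (\<lambda>q. q) (ch i) c) (at (pr p)) a"
    using frechet_derivative_ch_indep[of j p i "\<lambda>q. q" c] assms by simp
next
  assume "c \<in> charts_at M p \<and> u = frechet_derivative (local_rep (\<lambda>q. q) (ch i) c) (at (pr p)) a"
  then show "(c, u) \<in> const_field a p" using assms unfolding const_field_def by blast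
qed

lemma const_field_eq:
  assumes "i \<in> I" "p \<in> U i"
  shows "const_field a p = tangent_rel M p `` {(ch i, a)}"
  using assms by (auto simp: in_const_field_iff[OF assms] tangent_rel_def ch_charts_at)

lemma frechet_derivative_pr_lift:
  assumes f: "continuous_map T T f" and i: "i \<in> I" "p \<in> U i" and k: "k \<in> I" "f p \<in> U k"
    and pr_f: "\<And>x. x \<in> V i \<Longrightarrow> pr (f (s i x)) = x"
  shows "frechet_derivative (local_rep f (ch i) (ch k)) (at (pr p)) a = a"
proof -
  have "frechet_derivative (local_rep f (ch i) (ch k)) (at (pr p)) =
      frechet_derivative (\<lambda>x. x) (at (pr p))"
  proof (rule frechet_derivative_cong_open[OF open_ch_domain[OF i(1) ch_charts[OF k(1)] f]])
    show "pr p \<in> pr ` (U i \<inter> f -` fst (ch k))" using i k by simp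
    show "local_rep f (ch i) (ch k) y = y" if "y \<in> pr ` (U i \<inter> f -` fst (ch k))" for y
    proof -
      have "y \<in> V i" using that i by auto
      then show ?thesis using i pr_f by (simp add: local_rep_ch)
    qed
  qed
  also have "\<dots> = (\<lambda>v. v)"
    by (metis frechet_derivative_at has_derivative_ident)
  finally show ?thesis by simp
qed

lemma in_const_field_ch: "i \<in> I \<Longrightarrow> p \<in> U i \<Longrightarrow> (ch i, u) \<in> const_field a p \<longleftrightarrow> u = a"
  using frechet_derivative_pr_lift[of "\<lambda>q. q" i p i a]
  by (simp add: in_const_field_iff ch_charts_at)

lemma smooth_vector_field_const_field: "smooth_vector_field M (const_field a)"
  unfolding smooth_vector_field_def
proof (intro conjI ballI)
  fix p assume "p \<in> mpoints M"
  then obtain i where i: "i \<in> I" "p \<in> U i" using U_cover by auto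
  then show "const_field a p \<in> tangent_space M p"
    unfolding tangent_space_def const_field_eq[OF i] by (intro quotientI) (simp add: ch_charts_at)
next
  fix c assume c: "c \<in> charts M"
  note chart_c = charts_is_chart[OF c]
  define g where "g y = inv_into (fst c) (snd c) y" for y
  define \<xi> where "\<xi> y = (THE u. (c, u) \<in> const_field a (g y))" for y
  have g: "g (snd c p) = p" if "p \<in> fst c" for p
    using that is_chart_inj[OF chart_c] by (simp add: g_def)
  have \<xi>: "\<xi> (snd c p) = frechet_derivative (local_rep (\<lambda>q. q) (ch i) c) (at (pr p)) a"
    if "i \<in> I" "p \<in> U i" "p \<in> fst c" for i p
    using that c by (simp add: \<xi>_def g in_const_field_iff charts_at_def)
  have cov: "\<exists>i\<in>I. p \<in> U i" if "p \<in> fst c" for p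
    using that is_chart_subset[OF chart_c] U_cover by auto
  have "smooth_on {snd c p} \<xi>" if p: "p \<in> fst c" for p
  proof -
    obtain i where i: "i \<in> I" "p \<in> U i" using cov p by blast
    note ci = ch_charts[OF i(1)]
    \<comment> \<open>Near \<open>p\<close> the coordinates of the field in \<open>c\<close> are the
      derivative along \<open>a\<close> of the coordinate change from \<open>ch i\<close> to
      \<open>c\<close>, precomposed with the inverse change, and both factors are smooth.\<close>
    let ?O = "snd c ` (fst c \<inter> U i)" and ?D = "nderiv (local_rep (\<lambda>q. q) (ch i) c) [a]"
    have O: "open ?O"
      using open_rep_domain[OF _ chart_c is_chart_ch[OF i(1), folded mtop_M], of "\<lambda>q. q"] by simp
    have "smooth_on ?O (?D \<circ> local_rep (\<lambda>q. q) c (ch i))"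
    proof (rule smooth_on_compose[OF O])
      show "open (pr ` (U i \<inter> fst c))"
        using open_ch_domain[OF i(1) c, of "\<lambda>q. q"] by simp
      show "local_rep (\<lambda>q. q) c (ch i) ` ?O \<subseteq> pr ` (U i \<inter> fst c)"
        using is_chart_inj[OF chart_c] by (auto simp: local_rep_apply)
      show "smooth_on ?O (local_rep (\<lambda>q. q) c (ch i))"
        using charts_compatible[OF smooth_manifold_M c ci] by simp
      show "smooth_on (pr ` (U i \<inter> fst c)) ?D"
        using charts_compatible[OF smooth_manifold_M ci c] by (intro smooth_on_nderiv) simp
    qed
    moreover have "\<xi> y = (?D \<circ> local_rep (\<lambda>q. q) c (ch i)) y" if "y \<in> ?O" for y
      using that \<xi>[OF i(1)] is_chart_inj[OF chart_c] by (auto simp: local_rep_apply)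
    ultimately have "smooth_on ?O \<xi>"
      using smooth_on_cong[OF O, of \<xi> "?D \<circ> local_rep (\<lambda>q. q) c (ch i)"] by blast
    then show ?thesis by (rule smooth_on_subset) (use p i in auto)
  qed
  then have "smooth_on (snd c ` fst c) \<xi>" by (auto simp: smooth_on_def)
  moreover have "(c, \<xi> (snd c p)) \<in> const_field a p" if p: "p \<in> fst c" for p
  proof -
    obtain i where i: "i \<in> I" "p \<in> U i" using cov p by blast
    then show ?thesis using p c by (simp add: in_const_field_iff[OF i] \<xi> charts_at_def)
  qed
  ultimately show "\<exists>\<xi>. smooth_on (snd c ` fst c) \<xi> \<and> (\<forall>p\<in>fst c. (c, \<xi> (snd c p)) \<in> const_field a p)"
    by blast
qed

text \<open>Invariance of \<open>const_field a\<close> tested in the sheet charts only, where the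
  field is constant. This form is suited to computations along lines.\<close>

definition preserves :: "'e \<Rightarrow> ('p \<Rightarrow> 'p) \<Rightarrow> bool" where
  "preserves a f \<longleftrightarrow> smooth_map M M f \<and>
     (\<forall>i\<in>I. \<forall>k\<in>I. \<forall>p\<in>U i. f p \<in> U k \<longrightarrow>
        frechet_derivative (local_rep f (ch i) (ch k)) (at (pr p)) a = a)"

lemma smooth_map_continuous: "smooth_map M M f \<Longrightarrow> continuous_map T T f"
  by (simp add: smooth_map_def)

lemma vf_auts_preserves:
  assumes "f \<in> vf_auts M (const_field a)"
  shows "preserves a f"
  unfolding preserves_def
proof (intro conjI ballI impI)
  show "smooth_map M M f" using assms by (simp add: vf_auts_def diffeos_def)
  fix i k p assume i: "i \<in> I" and k: "k \<in> I" and p: "p \<in> U i" and fp: "f p \<in> U k"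
  have "p \<in> topspace T" using i p topspace_T by blast
  then have "tangent_map M M f p (const_field a p) = const_field a (f p)"
    using assms by (simp add: vf_auts_def)
  moreover have "(ch i, a) \<in> const_field a p" using i p by (simp add: in_const_field_ch)
  moreover have "ch k \<in> charts_at M (f p)" using k fp by (simp add: ch_charts_at)
  ultimately have "(ch k, frechet_derivative (local_rep f (ch i) (ch k)) (at (snd (ch i) p)) a)
      \<in> const_field a (f p)"
    unfolding tangent_map_def by blast
  then show "frechet_derivative (local_rep f (ch i) (ch k)) (at (pr p)) a = a"
    using k fp by (simp add: in_const_field_ch)
qed

lemma vf_autsI:
  assumes f: "f \<in> diffeos M" and pres: "preserves a f"
  shows "f \<in> vf_auts M (const_field a)"
proof -
  have sm: "smooth_map M M f" using pres by (simp add: preserves_def)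
  note cont = smooth_map_continuous[OF sm]
  have id: "continuous_map T T (\<lambda>q. q)" by simp
  have "tangent_map M M f p (const_field a p) = const_field a (f p)" if "p \<in> topspace T" for p
  proof -
    obtain i where i: "i \<in> I" "p \<in> U i" using U_cover \<open>p \<in> topspace T\<close> by blast
    have "f p \<in> topspace T" using cont that by (auto simp: continuous_map_def)
    then obtain k where k: "k \<in> I" "f p \<in> U k" using U_cover by blast
    \<comment> \<open>The local expression of \<open>f\<close> from \<open>ch i\<close> to
      \<open>d\<close> is factored in two ways: through \<open>c\<close> before \<open>f\<close> is
      applied, and through \<open>ch k\<close> after it. The second one contains the derivative that
      fixes \<open>a\<close>.\<close>
    have *: "frechet_derivative (local_rep f c d) (at (snd c p))
          (frechet_derivative (local_rep (\<lambda>q. q) (ch i) c) (at (pr p)) a) =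
        frechet_derivative (local_rep (\<lambda>q. q) (ch k) d) (at (pr (f p))) a"
      if c: "c \<in> charts_at M p" and d: "d \<in> charts_at M (f p)" for c d
    proof -
      from c d have cc: "c \<in> charts M" "p \<in> fst c" and dd: "d \<in> charts M" "f p \<in> fst d"
        by (auto simp: charts_at_def)
      note chs = is_chart_ch[OF i(1)] is_chart_ch[OF k(1)]
        charts_is_chart[OF cc(1), unfolded mtop_M] charts_is_chart[OF dd(1), unfolded mtop_M]
      have "frechet_derivative (local_rep (f \<circ> (\<lambda>q. q)) (ch i) d) (at (snd (ch i) p)) a =
          frechet_derivative (local_rep f c d) (at (snd c p))
            (frechet_derivative (local_rep (\<lambda>q. q) (ch i) c) (at (snd (ch i) p)) a)"
        using charts_compatible[OF smooth_manifold_M ch_charts[OF i(1)] cc(1)]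
          smooth_mapD[OF sm cc(1) dd(1)] i cc dd
        by (intro frechet_derivative_local_rep_comp[OF id cont chs(1,3,4)]) auto
      moreover have "frechet_derivative (local_rep ((\<lambda>q. q) \<circ> f) (ch i) d) (at (snd (ch i) p)) a =
          frechet_derivative (local_rep (\<lambda>q. q) (ch k) d) (at (snd (ch k) (f p)))
            (frechet_derivative (local_rep f (ch i) (ch k)) (at (snd (ch i) p)) a)"
        using charts_compatible[OF smooth_manifold_M ch_charts[OF k(1)] dd(1)]
          smooth_mapD[OF sm ch_charts[OF i(1)] ch_charts[OF k(1)]] i k dd
        by (intro frechet_derivative_local_rep_comp[OF cont id chs(1,2,4)]) auto
      moreover have "frechet_derivative (local_rep f (ch i) (ch k)) (at (pr p)) a = a"
        using pres i k by (simp add: preserves_def)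
      ultimately show ?thesis by (simp add: o_def)
    qed
    show ?thesis
    proof (intro equalityI subsetI)
      fix z assume "z \<in> tangent_map M M f p (const_field a p)"
      then obtain c u d where cu: "(c, u) \<in> const_field a p" "d \<in> charts_at M (f p)"
        "z = (d, frechet_derivative (local_rep f c d) (at (snd c p)) u)"
        unfolding tangent_map_def by blast
      then show "z \<in> const_field a (f p)"
        using * by (simp add: in_const_field_iff[OF i] in_const_field_iff[OF k])
    next
      fix z assume z: "z \<in> const_field a (f p)"
      obtain d w where dw: "z = (d, w)" by (cases z)
      then have d: "d \<in> charts_at M (f p)"
        "w = frechet_derivative (local_rep (\<lambda>q. q) (ch k) d) (at (pr (f p))) a"
        using z by (auto simp: in_const_field_iff[OF k])
      let ?u = "frechet_derivative (local_rep (\<lambda>q. q) (ch i) (ch i)) (at (pr p)) a"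
      have "(ch i, ?u) \<in> const_field a p" using i by (simp add: in_const_field_iff[OF i] ch_charts_at)
      moreover have "w = frechet_derivative (local_rep f (ch i) d) (at (snd (ch i) p)) ?u"
        using *[OF ch_charts_at[OF i] d(1)] d(2) by simp
      ultimately show "z \<in> tangent_map M M f p (const_field a p)"
        using d(1) unfolding tangent_map_def dw by blast
    qed
  qed
  then show ?thesis using f by (simp add: vf_auts_def)
qed

lemma preserves_inverse:
  assumes f: "preserves a f" and g: "smooth_map M M g"
    and gf: "\<And>p. p \<in> topspace T \<Longrightarrow> g (f p) = p" and fg: "\<And>p. p \<in> topspace T \<Longrightarrow> f (g p) = p"
  shows "preserves a g"
  unfolding preserves_def
proof (intro conjI ballI impI)
  fix k i q assume k: "k \<in> I" and i: "i \<in> I" and q: "q \<in> U k" "g q \<in> U i"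
  have sm: "smooth_map M M f" using f by (simp add: preserves_def)
  note cont = smooth_map_continuous[OF sm] smooth_map_continuous[OF g]
  define p where "p = g q"
  have p: "p \<in> U i" "f p = q" "p \<in> topspace T"
    using q fg k i topspace_T by (auto simp: p_def)
  have "frechet_derivative (local_rep (g \<circ> f) (ch i) (ch i)) (at (snd (ch i) p)) a =
      frechet_derivative (local_rep g (ch k) (ch i)) (at (snd (ch k) (f p)))
        (frechet_derivative (local_rep f (ch i) (ch k)) (at (snd (ch i) p)) a)"
    using smooth_mapD[OF sm ch_charts[OF i] ch_charts[OF k]]
      smooth_mapD[OF g ch_charts[OF k] ch_charts[OF i]] i k p q
    by (intro frechet_derivative_local_rep_comp[OF cont is_chart_ch[OF i] is_chart_ch[OF k]
        is_chart_ch[OF i]]) (auto simp: gf)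
  moreover have "frechet_derivative (local_rep f (ch i) (ch k)) (at (pr p)) a = a"
    using f i k p q by (simp add: preserves_def)
  moreover have "frechet_derivative (local_rep (g \<circ> f) (ch i) (ch i)) (at (pr p)) a = a"
  proof (rule frechet_derivative_pr_lift[OF continuous_map_compose[OF cont] i p(1) i])
    show "(g \<circ> f) p \<in> U i" using p(1,3) gf by simp
    show "pr ((g \<circ> f) (s i x)) = x" if "x \<in> V i" for x
    proof -
      have "s i x \<in> topspace T" using s_in_U[OF that] i topspace_T by blast
      then show ?thesis using i that gf by simp
    qed
  qed
  ultimately show "frechet_derivative (local_rep g (ch k) (ch i)) (at (pr q)) a = a"
    using p by simp
qed (rule g)

text \<open>The substitute for the flow. Along a line of direction \<open>a\<close> the projected
  image has velocity \<open>a\<close>, so its difference from \<open>t *\<^sub>R a\<close> has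
  derivative zero and is constant on the connected set \<open>J\<close>.\<close>

lemma preserves_line:
  assumes f: "preserves a f" and i: "i \<in> I" and J: "open J" "connected J"
    and line: "\<And>t. t \<in> J \<Longrightarrow> x + t *\<^sub>R a \<in> V i"
    and st: "t \<in> J" "t' \<in> J"
  shows "pr (f (s i (x + t *\<^sub>R a))) - t *\<^sub>R a = pr (f (s i (x + t' *\<^sub>R a))) - t' *\<^sub>R a"
proof (rule has_derivative_zero_unique_connected[OF J _ st])
  fix r assume r: "r \<in> J"
  have sm: "smooth_map M M f" using f by (simp add: preserves_def)
  note cont = smooth_map_continuous[OF sm]
  let ?y = "\<lambda>r. x + r *\<^sub>R a"
  have p: "s i (?y r) \<in> U i" using line[OF r] by simp
  then have "f (s i (?y r)) \<in> topspace T"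
    using cont i topspace_T by (auto simp: continuous_map_def)
  then obtain k where k: "k \<in> I" "f (s i (?y r)) \<in> U k" using U_cover by blast
  let ?O = "pr ` (U i \<inter> f -` U k)" and ?R = "local_rep f (ch i) (ch k)"
  have O: "open ?O" using open_ch_domain[OF i ch_charts[OF k(1)] cont] by simp
  have yr: "?y r \<in> ?O" using p k line[OF r] i by (force simp: image_iff)
  have "?R differentiable (at (?y r))"
    using smooth_mapD[OF sm ch_charts[OF i] ch_charts[OF k(1)]] yr
    by (simp add: smooth_on_differentiable)
  then have R: "(?R has_derivative frechet_derivative ?R (at (?y r))) (at (?y r))"
    by (simp add: frechet_derivative_works)
  have Ra: "frechet_derivative ?R (at (?y r)) a = a"
    using f i k p line[OF r] unfolding preserves_def by (metis pr_s)
  have lin: "linear (frechet_derivative ?R (at (?y r)))"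
    using R has_derivative_linear by blast
  have y: "(?y has_derivative (\<lambda>h. h *\<^sub>R a)) (at r)"
    by (auto intro!: derivative_eq_intros)
  have "((\<lambda>r. ?R (?y r)) has_derivative (\<lambda>h. frechet_derivative ?R (at (?y r)) (h *\<^sub>R a))) (at r)"
    by (rule has_derivative_compose[OF y R])
  then have "((\<lambda>r. ?R (?y r)) has_derivative (\<lambda>h. h *\<^sub>R a)) (at r)"
    using lin Ra by (simp add: linear_scale)
  \<comment> \<open>Every sheet chart has the coordinate map \<open>pr\<close>, so the local
    expression equals the projected image on all of \<open>J\<close>, even where \<open>f\<close>
    has left the sheet \<open>k\<close>.\<close>
  then have "((\<lambda>r. pr (f (s i (?y r)))) has_derivative (\<lambda>h. h *\<^sub>R a)) (at r)"
  proof (rule has_derivative_transform_within_open)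
    show "open J" by (rule J)
    show "?R (?y r) = pr (f (s i (?y r)))" if "r \<in> J" for r
      using line[OF that] i by (simp add: local_rep_ch)
  qed (rule r)
  then show "((\<lambda>r. pr (f (s i (?y r))) - r *\<^sub>R a) has_derivative (\<lambda>h. 0)) (at r)"
    by (auto intro!: derivative_eq_intros)
qed

end

section \<open>Deck transformations\<close>

lemma path_component_of_set_discrete_topology:
  assumes "x \<in> S"
  shows "path_component_of_set (discrete_topology S) x = {x}"
proof -
  have "connectedin (discrete_topology S) (path_component_of_set (discrete_topology S) x)"
    by (simp add: path_connectedin_imp_connectedin path_connectedin_path_component_of)
  then obtain a where "path_component_of_set (discrete_topology S) x \<subseteq> {a}"
    by (auto simp: connectedin_discrete_topology)
  moreover have "x \<in> path_component_of_set (discrete_topology S) x"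
    using assms by (simp add: path_component_of_refl)
  ultimately show ?thesis by blast
qed

text \<open>Path components of a discrete space are singletons, so the union in the product of
  \<open>pi0_group\<close> has a single member.\<close>

lemma pi0_group_discrete_iso:
  assumes "\<And>x y. x \<in> carrier G \<Longrightarrow> y \<in> carrier G \<Longrightarrow> x \<otimes>\<^bsub>G\<^esub> y \<in> carrier G"
  shows "(\<lambda>x. {x}) \<in> iso G (pi0_group G (discrete_topology (carrier G)))"
proof (rule isoI)
  note pc = path_component_of_set_discrete_topology[of _ "carrier G"]
  show "(\<lambda>x. {x}) \<in> hom G (pi0_group G (discrete_topology (carrier G)))"
    by (rule homI) (auto simp: pi0_group_def path_components_of_def pc assms intro: rev_image_eqI)
  show "bij_betw (\<lambda>x. {x}) (carrier G) (carrier (pi0_group G (discrete_topology (carrier G))))"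
    by (auto simp: bij_betw_def pi0_group_def path_components_of_def pc image_iff)
qed

context sheets
begin

text \<open>Deck transformations, described on sheets so that the local expressions are identities.
  Bijectivity is required separately.\<close>

definition deck :: "('p \<Rightarrow> 'p) \<Rightarrow> bool" where
  "deck f \<longleftrightarrow> (\<forall>i\<in>I. \<exists>k\<in>I. V k = V i \<and> (\<forall>x\<in>V i. f (s i x) = s k x))"

lemma pr_deck: "deck f \<Longrightarrow> p \<in> topspace T \<Longrightarrow> pr (f p) = pr p"
  using U_cover[of p] unfolding deck_def by (metis pr_in_V pr_s s_pr)

lemma continuous_map_deck:
  assumes "deck f"
  shows "continuous_map T T f"
proof (rule continuous_map_from_T)
  fix i assume "i \<in> I"
  then obtain k where k: "k \<in> I" "V k = V i" "\<forall>x\<in>V i. f (s i x) = s k x"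
    using assms unfolding deck_def by blast
  show "continuous_map (top_of_set (V i)) T (f \<circ> s i)"
    using continuous_map_s[OF k(1)] k(2,3) by (auto intro: continuous_map_eq)
qed

lemma smooth_map_deck:
  assumes f: "deck f"
  shows "smooth_map M M f"
proof (rule smooth_mapI[OF smooth_manifold_M smooth_manifold_M])
  show cont: "continuous_map (mtop M) (mtop M) f" using continuous_map_deck[OF f] by simp
  fix p assume "p \<in> mpoints M"
  then obtain i where i: "i \<in> I" "p \<in> U i" using U_cover by auto
  obtain k where k: "k \<in> I" "V k = V i" "\<And>x. x \<in> V i \<Longrightarrow> f (s i x) = s k x"
    using f i unfolding deck_def by blast
  have p: "f p \<in> U k" using k(3)[of "pr p"] i k(2) by (metis pr_in_V s_in_U s_pr)
  have "smooth_on (pr ` (U i \<inter> f -` U k)) (local_rep f (ch i) (ch k))"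
  proof (subst smooth_on_cong)
    show "open (pr ` (U i \<inter> f -` U k))"
      using open_ch_domain[OF i(1) ch_charts[OF k(1)]] cont by simp
    show "local_rep f (ch i) (ch k) y = y" if "y \<in> pr ` (U i \<inter> f -` U k)" for y
    proof -
      have "y \<in> V i" using that i by auto
      then show ?thesis using i k by (simp add: local_rep_ch)
    qed
  qed (rule smooth_on_ident)
  then show "\<exists>c\<in>charts M. \<exists>d\<in>charts M. p \<in> fst c \<and> f p \<in> fst d \<and>
      smooth_on (snd c ` (fst c \<inter> f -` fst d)) (local_rep f c d)"
    using i k p by (intro bexI[OF _ ch_charts[OF i(1)]] bexI[OF _ ch_charts[OF k(1)]]) auto
qed

lemma deck_in_vf_auts:
  assumes "f \<in> Bij (topspace T)" "deck f" "deck (\<lambda>p\<in>topspace T. inv_into (topspace T) f p)"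
  shows "f \<in> vf_auts M (const_field a)"
proof (rule vf_autsI)
  show "f \<in> diffeos M" using assms by (simp add: diffeos_def smooth_map_deck)
  have "frechet_derivative (local_rep f (ch i) (ch k)) (at (pr p)) a = a"
    if "i \<in> I" "k \<in> I" "p \<in> U i" "f p \<in> U k" for i k p
  proof (rule frechet_derivative_pr_lift[OF continuous_map_deck[OF assms(2)] that(1,3,2,4)])
    fix x assume x: "x \<in> V i"
    then have "s i x \<in> topspace T" using that(1) s_in_U topspace_T by blast
    then show "pr (f (s i x)) = x" using pr_deck[OF assms(2)] x that(1) by simp
  qed
  then show "preserves a f" using assms by (simp add: preserves_def smooth_map_deck)
qed

text \<open>The agreement set is closed by the Hausdorff property. It is open because near an
  agreement point both images lie in one sheet, on which \<open>pr\<close> is injective.\<close>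

lemma lift_unique:
  assumes conn: "connected_space T"
    and f: "continuous_map T T f" and g: "continuous_map T T g"
    and pr_eq: "\<And>p. p \<in> topspace T \<Longrightarrow> pr (f p) = pr (g p)"
    and q: "q \<in> topspace T" "f q = g q"
  shows "p \<in> topspace T \<Longrightarrow> f p = g p"
proof -
  let ?E = "{p \<in> topspace T. f p = g p}"
  have "closedin T ?E" by (rule closedin_continuous_maps_eq[OF Hausdorff_T f g])
  moreover have "openin T ?E"
  proof (subst openin_subopen, intro ballI)
    fix p assume p: "p \<in> ?E"
    then have "p \<in> topspace T" by simp
    then have "f p \<in> topspace T" by (rule funcset_mem[OF continuous_map_funspace[OF f]])
    then obtain k where k: "k \<in> I" "f p \<in> U k" using U_cover by blast
    let ?W = "{p \<in> topspace T. f p \<in> U k} \<inter> {p \<in> topspace T. g p \<in> U k}"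
    have "openin T ?W"
      using k f g openin_U by (intro openin_Int openin_continuous_map_preimage) auto
    moreover have "?W \<subseteq> ?E"
      using k pr_eq inj_on_pr[OF k(1)] by (auto dest: inj_onD)
    ultimately show "\<exists>W. openin T W \<and> p \<in> W \<and> W \<subseteq> ?E"
      using p k by (intro exI[of _ ?W]) auto
  qed
  ultimately have "?E = {} \<or> ?E = topspace T"
    using conn unfolding connected_space_clopen_in by blast
  then show "p \<in> topspace T \<Longrightarrow> f p = g p" using q by blast
qed

lemma Aut_topology_discrete:
  assumes sep: "\<And>f. f \<in> vf_auts M X \<Longrightarrow>
    \<exists>p\<in>topspace T. \<exists>k\<in>I. f p \<in> U k \<and> (\<forall>g\<in>vf_auts M X. g p \<in> U k \<longrightarrow> g = f)"
  shows "Aut_topology M X = discrete_topology (vf_auts M X)"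
proof -
  have sub: "vf_auts M X \<subseteq> diffeos M" by (auto simp: vf_auts_def)
  have "openin (Aut_topology M X) {f}" if f: "f \<in> vf_auts M X" for f
  proof -
    obtain p k where p: "p \<in> topspace T" and k: "k \<in> I" "f p \<in> U k"
      and only: "\<And>g. g \<in> vf_auts M X \<Longrightarrow> g p \<in> U k \<Longrightarrow> g = f"
      using sep[OF f] by blast
    obtain i where i: "i \<in> I" "p \<in> U i" using U_cover[OF p] by blast
    \<comment> \<open>Sending \<open>p\<close> into \<open>U k\<close> already singles out
      \<open>f\<close>. Hence order 0 suffices, and the radius 1 is arbitrary.\<close>
    let ?N = "weak_nbhd M M f (ch i) (ch k) {p} 0 1"
    have sm: "f \<in> smooth_maps M M"
      using f by (auto simp: vf_auts_def diffeos_def smooth_maps_def Bij_def)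
    have "openin (weak_topology M M) ?N"
      unfolding weak_topology_def
    proof (rule topology_generated_by_Basis, intro CollectI exI conjI)
      show "compactin (mtop M) {p}" using p by simp
    qed (use sm i k ch_charts in \<open>auto intro: zero_less_one\<close>)
    then have "openin (Aut_topology M X) (?N \<inter> diffeos M \<inter> vf_auts M X)"
      unfolding Aut_topology_def by (simp add: openin_subtopology_Int)
    moreover have "?N \<inter> diffeos M \<inter> vf_auts M X = {f}"
    proof (intro equalityI subsetI)
      fix g assume "g \<in> ?N \<inter> diffeos M \<inter> vf_auts M X"
      then have "g p \<in> U k" "g \<in> vf_auts M X" by (simp_all add: weak_nbhd_def)
      then show "g \<in> {f}" using only by simp
    next
      fix g assume "g \<in> {f}"
      moreover have "f \<in> ?N" using sm k by (simp add: weak_nbhd_def)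
      ultimately show "g \<in> ?N \<inter> diffeos M \<inter> vf_auts M X" using f sub by blast
    qed
    ultimately show ?thesis by simp
  qed
  moreover have "topspace (Aut_topology M X) = vf_auts M X"
  proof
    show "vf_auts M X \<subseteq> topspace (Aut_topology M X)"
      using calculation openin_subset by blast
  qed (simp add: Aut_topology_def)
  ultimately show ?thesis by (metis discrete_topology_unique)
qed

end

section \<open>The covering\<close>

text \<open>\<open>idx\<close> puts the windows at disjoint unit intervals of the
  \<open>a\<close>-coordinate. The bound \<open>n > N\<close> in \<open>dense_y\<close> lets the
  segment around \<open>y n\<close> reach any prescribed height. \<open>pt g x\<close> names the
  point with label \<open>g\<close> over \<open>x\<close> and leaves the type of points
  open.\<close>

locale slit_cover = group G for G :: "('g, 'z) monoid_scheme" (structure) +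
  fixes a b :: "'e::euclidean_space" and idx :: "'g \<Rightarrow> nat" and y :: "nat \<Rightarrow> 'e"
    and pt :: "'g \<Rightarrow> 'e \<Rightarrow> 'p"
  assumes finite_G: "finite (carrier G)"
    and a_Basis: "a \<in> Basis" and b_Basis: "b \<in> Basis" and a_neq_b: "a \<noteq> b"
    and inj_idx: "inj_on idx (carrier G)"
    and inj_y: "inj y" and a_y [simp]: "a \<bullet> y n = 0" and b_y: "b \<bullet> y n \<noteq> 0"
    and dense_y: "open W \<Longrightarrow> x \<in> W \<Longrightarrow> a \<bullet> x = 0 \<Longrightarrow> \<exists>n>N. y n \<in> W"
    and inj_pt: "g \<in> carrier G \<Longrightarrow> h \<in> carrier G \<Longrightarrow> pt g x = pt h x' \<longleftrightarrow> g = h \<and> x = x'"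
begin

lemma inner_ab [simp]: "a \<bullet> a = 1" "b \<bullet> b = 1" "a \<bullet> b = 0" "b \<bullet> a = 0"
  using a_Basis b_Basis a_neq_b by (auto simp: inner_Basis)

definition removed :: "'e set" where
  "removed = {y n + (\<sigma> * real n) *\<^sub>R a | n \<sigma>. 1 \<le> n \<and> \<sigma> \<in> {1, -1}}"

definition slit :: "'g \<Rightarrow> 'e set" where
  "slit k = {x. b \<bullet> x \<noteq> 0 \<or> real (idx k) < a \<bullet> x \<and> a \<bullet> x < real (idx k) + 1}"

definition win :: "'g \<Rightarrow> 'e set" where "win k = slit k - removed"

text \<open>Points in the window itself carry the upper label. The jump of labels at the hyperplane
  is harmless: labels only name points, and the topology comes from the sections.\<close>

definition sec :: "'g \<times> 'g \<Rightarrow> 'e \<Rightarrow> 'p" where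
  "sec i x = pt (if b \<bullet> x < 0 then fst i \<otimes> snd i else fst i) x"

definition proj :: "'p \<Rightarrow> 'e" where "proj p = (THE x. \<exists>g\<in>carrier G. p = pt g x)"

lemma proj_pt [simp]: "g \<in> carrier G \<Longrightarrow> proj (pt g x) = x"
  unfolding proj_def by (rule the_equality) (auto simp: inj_pt)

lemma removedI: "1 \<le> n \<Longrightarrow> \<sigma> \<in> {1, -1} \<Longrightarrow> y n + (\<sigma> * real n) *\<^sub>R a \<in> removed"
  unfolding removed_def by blast

lemma countable_removed: "countable removed"
proof -
  have "removed \<subseteq> (\<lambda>(n, \<sigma>). y n + (\<sigma> * real n) *\<^sub>R a) ` (UNIV \<times> {1, -1})"
    unfolding removed_def by force
  then show ?thesis by (rule countable_subset) auto
qed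

text \<open>The points of index \<open>n\<close> have \<open>a\<close>-coordinate \<open>n\<close>
  or \<open>- n\<close>, so a ball meets only finitely many of them, however dense the
  \<open>y n\<close> are.\<close>

lemma closed_removed: "closed removed"
  unfolding closed_limpt
proof (intro allI impI)
  fix x assume "x islimpt removed"
  then have "infinite (removed \<inter> ball x 1)" by (simp add: islimpt_eq_infinite_ball)
  moreover have "removed \<inter> ball x 1 \<subseteq>
      (\<lambda>(n, \<sigma>). y n + (\<sigma> * real n) *\<^sub>R a) ` ({..nat \<lceil>norm x + 1\<rceil>} \<times> {1, -1})"
  proof
    fix z assume z: "z \<in> removed \<inter> ball x 1"
    then obtain n \<sigma> where n: "z = y n + (\<sigma> * real n) *\<^sub>R a" "\<sigma> \<in> {1, -1}"
      unfolding removed_def by blast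
    have "real n = \<bar>a \<bullet> z\<bar>" using n by (auto simp: inner_add_right)
    also have "\<dots> \<le> norm z" using Basis_le_norm[OF a_Basis, of z] by (simp add: inner_commute)
    also have "\<dots> \<le> norm x + 1"
      using z norm_triangle_ineq2[of z x] by (auto simp: dist_norm norm_minus_commute)
    finally have "n \<le> nat \<lceil>norm x + 1\<rceil>" by linarith
    then show "z \<in> (\<lambda>(n, \<sigma>). y n + (\<sigma> * real n) *\<^sub>R a) ` ({..nat \<lceil>norm x + 1\<rceil>} \<times> {1, -1})"
      using n by auto
  qed
  then have "finite (removed \<inter> ball x 1)" by (rule finite_subset) auto
  ultimately show "x \<in> removed" by blast
qed

lemma open_slit: "open (slit k)"
proof -
  have "slit k = {x. b \<bullet> x \<noteq> 0} \<union> ({x. real (idx k) < a \<bullet> x} \<inter> {x. a \<bullet> x < real (idx k) + 1})"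
    by (auto simp: slit_def)
  then show ?thesis
    by (auto intro!: open_Un open_Int open_Collect_neq open_Collect_less continuous_intros)
qed

lemma open_win: "open (win k)"
  unfolding win_def by (rule open_Diff[OF open_slit closed_removed])

lemma connected_slit: "connected (slit k)"
proof (rule starlike_imp_connected)
  \<comment> \<open>The centre of the window. A segment from it to a point off the hyperplane leaves
    the hyperplane at once; a segment to a point of the window stays there by convexity.\<close>
  let ?c = "(real (idx k) + 1/2) *\<^sub>R a"
  have "closed_segment ?c x \<subseteq> slit k" if x: "x \<in> slit k" for x
  proof
    fix z assume "z \<in> closed_segment ?c x"
    then obtain u where u: "0 \<le> u" "u \<le> 1" "z = (1 - u) *\<^sub>R ?c + u *\<^sub>R x"
      by (auto simp: in_segment)
    show "z \<in> slit k"
    proof (cases "u = 0 \<or> b \<bullet> x \<noteq> 0")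
      case True
      then show ?thesis using u by (auto simp: slit_def inner_add_right)
    next
      case False
      let ?J = "{real (idx k)<..<real (idx k) + 1}"
      have "real (idx k) + 1/2 \<in> ?J" "a \<bullet> x \<in> ?J" using False x by (auto simp: slit_def)
      then have "(1 - u) *\<^sub>R (real (idx k) + 1/2) + u *\<^sub>R (a \<bullet> x) \<in> ?J"
        using u by (intro convexD_alt) simp_all
      then show ?thesis using u by (simp add: slit_def inner_add_right)
    qed
  qed
  moreover have "?c \<in> slit k" by (simp add: slit_def)
  ultimately show "starlike (slit k)" unfolding starlike_def by blast
qed

lemma connected_win: "connected (win k)"
proof -
  have "card {a, b} \<le> DIM('e)" using a_Basis b_Basis by (intro card_mono) auto
  then have "2 \<le> DIM('e)" using a_neq_b by simp
  then show ?thesis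
    unfolding win_def using open_slit connected_slit countable_removed
    by (rule connected_open_diff_countable)
qed

lemma slit_inter: "k \<in> carrier G \<Longrightarrow> k' \<in> carrier G \<Longrightarrow> k \<noteq> k' \<Longrightarrow> x \<in> slit k \<Longrightarrow> x \<in> slit k' \<Longrightarrow> b \<bullet> x \<noteq> 0"
  using inj_onD[OF inj_idx, of k k'] by (force simp: slit_def)

text \<open>Two sheets over the same window agree everywhere or nowhere; over different windows the
  label can only jump across the hyperplane orthogonal to \<open>b\<close>, which the intersection avoids.\<close>

lemma open_label_condition:
  assumes "k \<in> carrier G" "k' \<in> carrier G" "k = k' \<Longrightarrow> A = B"
  shows "open {x \<in> win k \<inter> win k'. if b \<bullet> x < 0 then A else B}"
proof (cases "k = k'")
  case True
  then show ?thesis using assms open_win by (cases A) auto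
next
  case False
  have "{x \<in> win k \<inter> win k'. if b \<bullet> x < 0 then A else B} =
      win k \<inter> win k' \<inter> ({x. b \<bullet> x < 0 \<and> A} \<union> {x. 0 < b \<bullet> x \<and> B})"
  proof (rule Set.set_eqI)
    fix x show "x \<in> {x \<in> win k \<inter> win k'. if b \<bullet> x < 0 then A else B} \<longleftrightarrow>
      x \<in> win k \<inter> win k' \<inter> ({x. b \<bullet> x < 0 \<and> A} \<union> {x. 0 < b \<bullet> x \<and> B})"
      using slit_inter[OF assms(1,2) False, of x]
      by (cases "b \<bullet> x" "0::real" rule: linorder_cases) (auto simp: win_def)
  qed
  moreover have "open ({x. b \<bullet> x < 0 \<and> A} \<union> {x. 0 < b \<bullet> x \<and> B})"
    by (cases A; cases B) (auto intro!: open_Un open_Collect_less continuous_intros)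
  ultimately show ?thesis using open_win by auto
qed

lemma sec_eq_iff:
  assumes "i \<in> carrier G \<times> carrier G" "j \<in> carrier G \<times> carrier G"
  shows "sec i x = sec j x \<longleftrightarrow>
    (if b \<bullet> x < 0 then fst i \<otimes> snd i = fst j \<otimes> snd j else fst i = fst j)"
  using assms by (auto simp: sec_def inj_pt)

sublocale sheets "carrier G \<times> carrier G" "\<lambda>i. win (snd i)" sec proj
proof
  show "finite (carrier G \<times> carrier G)" using finite_G by simp
  show "open (win (snd i))" for i by (rule open_win)
  show "proj (sec i x) = x" if "i \<in> carrier G \<times> carrier G" for i x
    using that by (auto simp: sec_def)
  fix i j assume i: "i \<in> carrier G \<times> carrier G" and j: "j \<in> carrier G \<times> carrier G"
  have lab: "snd i = snd j \<Longrightarrow> fst i \<otimes> snd i = fst j \<otimes> snd j \<longleftrightarrow> fst i = fst j"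
    using i j by auto
  have mem: "snd i \<in> carrier G" "snd j \<in> carrier G" using i j by auto
  show "open {x \<in> win (snd i) \<inter> win (snd j). sec i x = sec j x}"
    unfolding sec_eq_iff[OF i j] by (rule open_label_condition[OF mem lab])
  have "open {x \<in> win (snd i) \<inter> win (snd j).
      if b \<bullet> x < 0 then \<not> fst i \<otimes> snd i = fst j \<otimes> snd j else \<not> fst i = fst j}"
    by (rule open_label_condition[OF mem]) (use lab in blast)
  moreover have "{x \<in> win (snd i) \<inter> win (snd j). sec i x \<noteq> sec j x} = {x \<in> win (snd i) \<inter> win (snd j).
      if b \<bullet> x < 0 then \<not> fst i \<otimes> snd i = fst j \<otimes> snd j else \<not> fst i = fst j}"
    unfolding sec_eq_iff[OF i j] by auto
  ultimately show "open {x \<in> win (snd i) \<inter> win (snd j). sec i x \<noteq> sec j x}" by simp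
  fix x assume "x \<in> win (snd i)" "x \<in> win (snd j)"
  \<comment> \<open>The label on the upper side for which the sheet over the window of
    \<open>snd i\<close> passes through \<open>sec j x\<close>: below the hyperplane, the factor
    \<open>snd i\<close> has to be cancelled.\<close>
  let ?h = "if b \<bullet> x < 0 then (fst j \<otimes> snd j) \<otimes> inv (snd i) else fst j"
  have "(?h, snd i) \<in> carrier G \<times> carrier G" using i j by auto
  moreover have "sec (?h, snd i) x = sec j x" using i j by (auto simp: sec_def m_assoc)
  ultimately show "\<exists>k\<in>carrier G \<times> carrier G. win (snd k) = win (snd i) \<and> sec k x = sec j x"
    by (metis snd_conv)
qed

lemma obtain_pt:
  assumes "p \<in> topspace T"
  obtains g x k where "g \<in> carrier G" "k \<in> carrier G" "x \<in> win k" "p = pt g x"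
proof -
  obtain i where i: "i \<in> carrier G \<times> carrier G" "p \<in> U i" using U_cover[OF assms] by blast
  show ?thesis
  proof (rule that)
    show "p = pt (if b \<bullet> proj p < 0 then fst i \<otimes> snd i else fst i) (proj p)"
      using s_pr[OF i] by (simp add: sec_def)
    show "proj p \<in> win (snd i)" using pr_in_V[OF i] .
  qed (use i in auto)
qed

lemma pt_topspace:
  assumes "g \<in> carrier G" "k \<in> carrier G" "x \<in> win k"
  shows "pt g x \<in> topspace T"
proof -
  let ?i = "(if b \<bullet> x < 0 then g \<otimes> inv k else g, k)"
  have "?i \<in> carrier G \<times> carrier G" using assms by auto
  moreover have "sec ?i x = pt g x" using assms by (auto simp: sec_def m_assoc)
  moreover have "sec ?i x \<in> U ?i" using assms by (intro s_in_U) simp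
  ultimately show ?thesis unfolding topspace_T by (metis UN_I)
qed

section \<open>Left translations of the labels\<close>

definition lab :: "'p \<Rightarrow> 'g" where "lab p = (THE g. g \<in> carrier G \<and> p = pt g (proj p))"

lemma lab_pt [simp]: "g \<in> carrier G \<Longrightarrow> lab (pt g x) = g"
  unfolding lab_def by (rule the_equality) (auto simp: inj_pt)

definition L :: "'g \<Rightarrow> 'p \<Rightarrow> 'p" where
  "L h = (\<lambda>p\<in>topspace T. pt (h \<otimes> lab p) (proj p))"

lemma L_pt:
  assumes "g \<in> carrier G" "k \<in> carrier G" "x \<in> win k"
  shows "L h (pt g x) = pt (h \<otimes> g) x"
  using assms pt_topspace[OF assms] by (simp add: L_def)

lemma L_topspace: "h \<in> carrier G \<Longrightarrow> p \<in> topspace T \<Longrightarrow> L h p \<in> topspace T"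
  by (metis L_pt m_closed obtain_pt pt_topspace)

lemma L_L:
  assumes "h \<in> carrier G" "h' \<in> carrier G" "p \<in> topspace T"
  shows "L h (L h' p) = L (h \<otimes> h') p"
proof -
  obtain g x k where g: "g \<in> carrier G" "k \<in> carrier G" "x \<in> win k" "p = pt g x"
    using obtain_pt[OF assms(3)] .
  then show ?thesis using assms by (simp add: L_pt m_assoc)
qed

lemma L_one: "p \<in> topspace T \<Longrightarrow> L \<one> p = p"
  by (metis L_pt l_one obtain_pt)

lemma L_Bij:
  assumes "h \<in> carrier G"
  shows "L h \<in> Bij (topspace T)"
proof -
  have "bij_betw (L h) (topspace T) (topspace T)"
    by (rule bij_betwI[where g = "L (inv h)"]) (use assms in \<open>auto simp: L_topspace L_L L_one\<close>)
  then show ?thesis by (simp add: Bij_def L_def)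
qed

lemma L_inverse:
  assumes "h \<in> carrier G"
  shows "(\<lambda>p\<in>topspace T. inv_into (topspace T) (L h) p) = L (inv h)"
proof
  fix p
  show "(\<lambda>p\<in>topspace T. inv_into (topspace T) (L h) p) p = L (inv h) p"
  proof (cases "p \<in> topspace T")
    case True
    then have "L h (L (inv h) p) = p" "L (inv h) p \<in> topspace T"
      using assms by (auto simp: L_L L_one L_topspace)
    then show ?thesis
      using L_Bij[OF assms] True by (simp add: Bij_def bij_betw_def inv_into_f_eq)
  qed (simp add: L_def)
qed

lemma deck_L:
  assumes "h \<in> carrier G"
  shows "deck (L h)"
  unfolding deck_def
proof
  fix i assume i: "i \<in> carrier G \<times> carrier G"
  have "L h (sec i x) = sec (h \<otimes> fst i, snd i) x" if "x \<in> win (snd i)" for x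
    using that i assms by (auto simp: sec_def L_pt[of _ "snd i"] m_assoc)
  then show "\<exists>k\<in>carrier G \<times> carrier G. win (snd k) = win (snd i) \<and>
      (\<forall>x\<in>win (snd i). L h (sec i x) = sec k x)"
    using i assms by (intro bexI[of _ "(h \<otimes> fst i, snd i)"]) auto
qed

lemma L_vf_auts: "h \<in> carrier G \<Longrightarrow> L h \<in> vf_auts M (const_field v)"
  by (rule deck_in_vf_auts) (simp_all add: L_Bij deck_L L_inverse)

lemma open_minus_removed:
  assumes "open W" "W \<noteq> {}"
  shows "\<exists>x\<in>W. x \<notin> removed"
proof -
  obtain x e where "0 < e" "ball x e \<subseteq> W" using assms open_contains_ball by blast
  then show ?thesis
    using uncountable_ball countable_subset[OF _ countable_removed] by blast
qed

end

section \<open>Rigidity\<close>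

context slit_cover
begin

lemma connected_component_sheet:
  assumes "i \<in> carrier G \<times> carrier G" "p \<in> U i" "q \<in> U i"
  shows "connected_component_of T p q"
proof -
  have "connectedin (top_of_set (win (snd i))) (win (snd i))"
    using connected_win by (simp add: connectedin_subtopology)
  then have "connectedin T (sec i ` win (snd i))"
    by (rule connectedin_continuous_map_image[OF continuous_map_s[OF assms(1)]])
  then show ?thesis using assms unfolding connected_component_of_def U_def by blast
qed

text \<open>A base point off the hyperplane belongs to all windows at once, so the sheets over
  different windows can be compared there.\<close>

lemma ex_up: "\<exists>x. 0 < b \<bullet> x \<and> (\<forall>k. x \<in> win k)"
proof -
  have "open {x. 0 < b \<bullet> x}" by (intro open_Collect_less continuous_intros)
  moreover have "b \<in> {x. 0 < b \<bullet> x}" by simp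
  ultimately obtain x where "0 < b \<bullet> x" "x \<notin> removed"
    using open_minus_removed[of "{x. 0 < b \<bullet> x}"] by blast
  then show ?thesis by (intro exI[of _ x]) (auto simp: win_def slit_def)
qed

lemma ex_down: "\<exists>x. b \<bullet> x < 0 \<and> (\<forall>k. x \<in> win k)"
proof -
  have "open {x. b \<bullet> x < 0}" by (intro open_Collect_less continuous_intros)
  moreover have "- b \<in> {x. b \<bullet> x < 0}" by simp
  ultimately obtain x where "b \<bullet> x < 0" "x \<notin> removed"
    using open_minus_removed[of "{x. b \<bullet> x < 0}"] by blast
  then show ?thesis by (intro exI[of _ x]) (auto simp: win_def slit_def)
qed

text \<open>Going down through the window of \<open>k\<close> multiplies the label by \<open>k\<close>, so every label is reached
  from \<open>\<one>\<close>.\<close>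

lemma connected_T: "connected_space T"
proof -
  obtain u where u: "0 < b \<bullet> u" "\<And>k. u \<in> win k" using ex_up by blast
  obtain d where d: "b \<bullet> d < 0" "\<And>k. d \<in> win k" using ex_down by blast
  have up: "pt g u \<in> U (g, k)" if "g \<in> carrier G" "k \<in> carrier G" for g k
    using s_in_U[of u "(g, k)"] u by (simp add: sec_def)
  have down: "pt (g \<otimes> k) d \<in> U (g, k)" if "g \<in> carrier G" "k \<in> carrier G" for g k
    using s_in_U[of d "(g, k)"] d by (simp add: sec_def)
  have step: "connected_component_of T (pt g u) (pt (g \<otimes> k) d)"
    if "g \<in> carrier G" "k \<in> carrier G" for g k
    using connected_component_sheet[of "(g, k)"] up down that by simp
  \<comment> \<open>Down from the label \<open>\<one>\<close> through the window of
    \<open>g\<close>, then up through the window of \<open>\<one>\<close>, which keeps the label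
    \<open>g\<close>.\<close>
  have base: "connected_component_of T (pt \<one> u) (pt g u)" if g: "g \<in> carrier G" for g
  proof -
    have "connected_component_of T (pt \<one> u) (pt g d)" using step[of \<one> g] g by simp
    moreover have "connected_component_of T (pt g d) (pt g u)"
      using step[of g \<one>] g by (simp add: connected_component_of_sym)
    ultimately show ?thesis by (rule connected_component_of_trans)
  qed
  have all: "connected_component_of T (pt \<one> u) p" if p: "p \<in> topspace T" for p
  proof -
    obtain i where i: "i \<in> carrier G \<times> carrier G" "p \<in> U i" using U_cover[OF p] by blast
    then have g: "fst i \<in> carrier G" and "pt (fst i) u \<in> U i"
      using up[of "fst i" "snd i"] by auto
    then have "connected_component_of T (pt (fst i) u) p"
      using connected_component_sheet[OF i(1) _ i(2)] by blast
    with base[OF g] show ?thesis by (rule connected_component_of_trans)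
  qed
  show ?thesis
    unfolding connected_space_iff_connected_component
  proof (intro ballI)
    fix p q assume "p \<in> topspace T" "q \<in> topspace T"
    then show "connected_component_of T p q"
      using all[of p] all[of q] connected_component_of_trans[of T p "pt \<one> u" q]
      by (simp add: connected_component_of_sym)
  qed
qed

section \<open>Segments over the \<open>y n\<close> and their images\<close>

lemma proj_topspace:
  assumes "p \<in> topspace T"
  shows "\<exists>k\<in>carrier G. proj p \<in> win k"
proof -
  obtain g x k where "g \<in> carrier G" "k \<in> carrier G" "x \<in> win k" "p = pt g x"
    using obtain_pt[OF assms] .
  then show ?thesis by auto
qed

text \<open>As the \<open>y n\<close> are distinct and orthogonal to \<open>a\<close>, removed
  points on one line of direction \<open>a\<close> have the same index \<open>k\<close>. The two
  ends differ by \<open>2n\<close>, so they have opposite signs and \<open>k = n\<close>, which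
  makes \<open>y n\<close> their midpoint.\<close>

lemma removed_segment:
  assumes n: "1 \<le> n" and top: "z + real n *\<^sub>R a \<in> removed" and bot: "z - real n *\<^sub>R a \<in> removed"
  shows "z = y n"
proof -
  obtain k \<sigma> where k: "z + real n *\<^sub>R a = y k + (\<sigma> * real k) *\<^sub>R a" "1 \<le> k" "\<sigma> = 1 \<or> \<sigma> = - 1"
    using top unfolding removed_def by blast
  obtain l \<tau> where l: "z - real n *\<^sub>R a = y l + (\<tau> * real l) *\<^sub>R a" "1 \<le> l" "\<tau> = 1 \<or> \<tau> = - 1"
    using bot unfolding removed_def by blast
  have ak: "a \<bullet> z + real n = \<sigma> * real k" and al: "a \<bullet> z - real n = \<tau> * real l"
    using arg_cong[OF k(1), of "inner a"] arg_cong[OF l(1), of "inner a"]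
    by (simp_all add: inner_add_right inner_diff_right)
  have "y k = z + real n *\<^sub>R a - (a \<bullet> z + real n) *\<^sub>R a" "y l = z - real n *\<^sub>R a - (a \<bullet> z - real n) *\<^sub>R a"
    unfolding ak al k(1) l(1) by simp_all
  then have yk: "y k = z - (a \<bullet> z) *\<^sub>R a" and "y l = z - (a \<bullet> z) *\<^sub>R a"
    by (simp_all add: algebra_simps)
  then have "k = l" using injD[OF inj_y, of k l] by simp
  then have "a \<bullet> z = 0 \<and> real n = real k"
    using ak al k(2,3) l(3) n by auto
  then show ?thesis using yk by simp
qed

lemma y_segment_in_win:
  assumes "1 \<le> n" "\<bar>t\<bar> < real n"
  shows "y n + t *\<^sub>R a \<in> win k"
proof -
  have "y n + t *\<^sub>R a \<notin> removed"
  proof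
    assume "y n + t *\<^sub>R a \<in> removed"
    then obtain m \<sigma> where m: "y n + t *\<^sub>R a = y m + (\<sigma> * real m) *\<^sub>R a" "\<sigma> = 1 \<or> \<sigma> = - 1"
      unfolding removed_def by blast
    have "t = \<sigma> * real m"
      using arg_cong[OF m(1), of "inner a"] by (simp add: inner_add_right)
    moreover from this have "n = m" using m injD[OF inj_y, of n m] by simp
    ultimately show False using assms m(2) by auto
  qed
  then show ?thesis using b_y[of n] by (simp add: win_def slit_def inner_add_right)
qed

text \<open>\<open>z\<close> lies on the image of the leaf through \<open>y n\<close>, and \<open>h\<close> is the inverse of the automorphism: were
  the image leaf longer, \<open>h\<close> would carry it over a removed point.\<close>

lemma automorphism_end:
  assumes h: "preserves a h" and j: "j \<in> carrier G \<times> carrier G"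
    and n: "1 \<le> n" and \<sigma>: "\<sigma> \<in> {1, -1}"
    and seg: "\<And>t. \<bar>t\<bar> < real n \<Longrightarrow> z + t *\<^sub>R a \<in> win (snd j)"
    and hz: "proj (h (sec j z)) = y n" and bz: "b \<bullet> z \<noteq> 0"
  shows "z + (\<sigma> * real n) *\<^sub>R a \<in> removed"
proof (rule ccontr)
  let ?w = "win (snd j)"
  assume "z + (\<sigma> * real n) *\<^sub>R a \<notin> removed"
  then have "z + (\<sigma> * real n) *\<^sub>R a \<in> ?w" using bz by (simp add: win_def slit_def inner_add_right)
  moreover have "open {t. z + t *\<^sub>R a \<in> ?w}"
    using continuous_open_vimage[OF open_win, of "\<lambda>t. z + t *\<^sub>R a" "snd j"]
    by (simp add: vimage_def continuous_intros)
  ultimately obtain e where e: "0 < e" "ball (\<sigma> * real n) e \<subseteq> {t. z + t *\<^sub>R a \<in> ?w}"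
    unfolding open_contains_ball by blast
  \<comment> \<open>\<open>seg\<close> says nothing about the opposite end point, so the interval is
    prolonged only past \<open>\<sigma> * real n\<close>.\<close>
  let ?J = "if \<sigma> = 1 then {- real n<..<real n + e} else {- real n - e<..<real n}"
  have line: "z + t *\<^sub>R a \<in> ?w" if t: "t \<in> ?J" for t
  proof (cases "\<bar>t\<bar> < real n")
    case False
    then have "t \<in> ball (\<sigma> * real n) e"
      using t \<sigma> by (auto simp: dist_real_def split: if_splits)
    then show ?thesis using e by blast
  qed (rule seg)
  have J: "open ?J" "connected ?J" by auto
  have st: "\<sigma> * real n \<in> ?J" "0 \<in> ?J" using e n \<sigma> by auto
  have "proj (h (sec j (z + (\<sigma> * real n) *\<^sub>R a))) - (\<sigma> * real n) *\<^sub>R a = proj (h (sec j (z + 0 *\<^sub>R a))) - 0 *\<^sub>R a"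
    by (rule preserves_line[OF h j J line st])
  then have "proj (h (sec j (z + (\<sigma> * real n) *\<^sub>R a))) = y n + (\<sigma> * real n) *\<^sub>R a"
    using hz by (simp add: algebra_simps)
  moreover have "h (sec j (z + (\<sigma> * real n) *\<^sub>R a)) \<in> topspace T"
  proof -
    have "continuous_map T T h" using h smooth_map_continuous by (simp add: preserves_def)
    moreover have "sec j (z + (\<sigma> * real n) *\<^sub>R a) \<in> topspace T"
      unfolding topspace_T by (rule UN_I[OF j]) (rule s_in_U[OF line[OF st(1)]])
    ultimately show ?thesis by (rule funcset_mem[OF continuous_map_funspace])
  qed
  ultimately obtain k where "y n + (\<sigma> * real n) *\<^sub>R a \<in> win k"
    using proj_topspace[of "h (sec j (z + (\<sigma> * real n) *\<^sub>R a))"] by auto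
  then show False using removedI[OF n \<sigma>] by (simp add: win_def)
qed

lemma vf_auts_inverse:
  assumes "f \<in> vf_auts M (const_field a)"
  obtains h where "preserves a h" "\<And>p. p \<in> topspace T \<Longrightarrow> h (f p) = p"
proof -
  let ?h = "\<lambda>p\<in>topspace T. inv_into (topspace T) f p"
  have f: "bij_betw f (topspace T) (topspace T)" and sm: "smooth_map M M ?h"
    using assms by (auto simp: vf_auts_def diffeos_def Bij_def)
  have hf: "?h (f p) = p" if "p \<in> topspace T" for p
    using f that by (auto simp: bij_betw_def)
  have fh: "f (?h p) = p" if "p \<in> topspace T" for p
    using f that by (auto simp: bij_betw_def f_inv_into_f)
  show ?thesis
    by (rule that[OF preserves_inverse[OF vf_auts_preserves[OF assms] sm hf fh] hf])
qed

text \<open>By \<open>preserves_line\<close> the segment is translated as a whole, with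
  \<open>z\<close> the new centre. \<open>automorphism_end\<close>, applied to the inverse, shows
  that both ends of the translate are removed, and \<open>removed_segment\<close> then identifies
  \<open>z\<close>.\<close>

lemma vf_auts_proj_y:
  assumes f: "f \<in> vf_auts M (const_field a)" and n: "1 \<le> n" and i: "i \<in> carrier G \<times> carrier G"
    and t: "\<bar>t\<bar> < real n"
  shows "proj (f (sec i (y n + t *\<^sub>R a))) = y n + t *\<^sub>R a"
proof -
  obtain h where h: "preserves a h" "\<And>p. p \<in> topspace T \<Longrightarrow> h (f p) = p"
    using vf_auts_inverse[OF f] by blast
  have pf: "preserves a f" by (rule vf_auts_preserves[OF f])
  then have cont: "continuous_map T T f" by (simp add: preserves_def smooth_map_continuous)
  have top: "sec i (y n + t *\<^sub>R a) \<in> topspace T" if "\<bar>t\<bar> < real n" for t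
    unfolding topspace_T by (intro UN_I[OF i] s_in_U y_segment_in_win n that)
  have ftop: "f (sec i (y n + t *\<^sub>R a)) \<in> topspace T" if "\<bar>t\<bar> < real n" for t
    by (rule funcset_mem[OF continuous_map_funspace[OF cont] top[OF that]])
  define z where "z = proj (f (sec i (y n)))"
  have image: "proj (f (sec i (y n + t *\<^sub>R a))) = z + t *\<^sub>R a" if t: "\<bar>t\<bar> < real n" for t
  proof -
    have "proj (f (sec i (y n + t *\<^sub>R a))) - t *\<^sub>R a =
        proj (f (sec i (y n + 0 *\<^sub>R a))) - 0 *\<^sub>R a"
      by (rule preserves_line[OF pf i, of "{- real n<..<real n}"])
        (use t n in \<open>auto intro!: y_segment_in_win\<close>)
    then show ?thesis by (simp add: z_def algebra_simps)
  qed
  have leaf: "\<exists>k\<in>carrier G. z + t *\<^sub>R a \<in> win k" if "\<bar>t\<bar> < real n" for t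
    using proj_topspace[OF ftop[OF that]] image[OF that] by simp
  have bz: "b \<bullet> z \<noteq> 0"
  proof
    assume bz: "b \<bullet> z = 0"
    \<comment> \<open>Leaves inside the hyperplane are excluded here: a segment of half-length
      \<open>n \<ge> 1\<close> contains a point with integral \<open>a\<close>-coordinate, and no
      window does.\<close>
    let ?t = "of_int \<lceil>a \<bullet> z\<rceil> - a \<bullet> z"
    have "\<bar>?t\<bar> < real n" using n by linarith
    then obtain k where "z + ?t *\<^sub>R a \<in> win k" using leaf by blast
    then have "real_of_int (int (idx k)) < of_int \<lceil>a \<bullet> z\<rceil>"
      "of_int \<lceil>a \<bullet> z\<rceil> < real_of_int (int (idx k) + 1)"
      using bz by (auto simp: win_def slit_def inner_add_right)
    then have "int (idx k) < \<lceil>a \<bullet> z\<rceil>" "\<lceil>a \<bullet> z\<rceil> < int (idx k) + 1"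
      unfolding of_int_less_iff .
    then show False by simp
  qed
  have q: "f (sec i (y n)) \<in> topspace T" "sec i (y n) \<in> topspace T"
    using ftop[of 0] top[of 0] n by auto
  then obtain j where j: "j \<in> carrier G \<times> carrier G" "f (sec i (y n)) \<in> U j" using U_cover by blast
  have "sec j z = f (sec i (y n))" unfolding z_def by (rule s_pr[OF j])
  then have hz: "proj (h (sec j z)) = y n"
    using h(2)[OF q(2)] pr_s[OF i, of "y n"] y_segment_in_win[OF n, of 0] n by simp
  \<comment> \<open>The window given by \<open>leaf\<close> may vary with \<open>t\<close>. Off the
    hyperplane all windows have the same points, so the segment lies over the base of the single
    sheet \<open>j\<close>.\<close>
  have seg: "z + t *\<^sub>R a \<in> win (snd j)" if "\<bar>t\<bar> < real n" for t
    using leaf[OF that] bz by (auto simp: win_def slit_def inner_add_right)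
  have "z + real n *\<^sub>R a \<in> removed" "z - real n *\<^sub>R a \<in> removed"
    using automorphism_end[OF h(1) j(1) n _ seg hz bz, of 1]
      automorphism_end[OF h(1) j(1) n _ seg hz bz, of "- 1"] by auto
  then have "z = y n" by (rule removed_segment[OF n])
  then show ?thesis using image[OF t] by simp
qed

text \<open>Near the orthogonal projection of \<open>x\<close> to the hyperplane
  \<open>a \<bullet> v = 0\<close> there is a \<open>y n\<close> with \<open>n\<close> larger than
  the height of \<open>x\<close>, so its segment reaches that height.\<close>

lemma y_segments_dense:
  assumes "open W" "x \<in> W"
  shows "\<exists>n t. 1 \<le> n \<and> \<bar>t\<bar> < real n \<and> y n + t *\<^sub>R a \<in> W"
proof -
  let ?t = "a \<bullet> x" and ?x = "x - (a \<bullet> x) *\<^sub>R a"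
  let ?W = "{v. v + ?t *\<^sub>R a \<in> W}"
  have "open ?W"
    using continuous_open_vimage[OF assms(1), of "\<lambda>v. v + ?t *\<^sub>R a"]
    by (simp add: vimage_def continuous_intros)
  moreover have "?x \<in> ?W" using assms by simp
  moreover have "a \<bullet> ?x = 0" by (simp add: inner_diff_right)
  ultimately obtain n where n: "nat \<lceil>\<bar>?t\<bar>\<rceil> < n" "y n \<in> ?W" using dense_y by blast
  then have "\<bar>?t\<bar> < real n" "1 \<le> n" by linarith+
  then show ?thesis using n(2) by blast
qed

lemma vf_auts_proj:
  assumes f: "f \<in> vf_auts M (const_field a)" and p: "p \<in> topspace T"
  shows "proj (f p) = proj p"
proof (rule ccontr)
  assume ne: "proj (f p) \<noteq> proj p"
  have "continuous_map T T f"
    using vf_auts_preserves[OF f] by (simp add: preserves_def smooth_map_continuous)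
  then have cont: "continuous_map T euclidean (\<lambda>p. proj (f p))"
    using continuous_map_compose[OF _ continuous_map_pr] by (simp add: o_def)
  have "closedin T {p \<in> topspace T. proj (f p) = proj p}"
    by (rule closedin_continuous_maps_eq[OF _ cont continuous_map_pr]) simp
  then have "openin T (topspace T - {p \<in> topspace T. proj (f p) = proj p})" by blast
  moreover obtain i where i: "i \<in> carrier G \<times> carrier G" "p \<in> U i" using U_cover[OF p] by blast
  ultimately have "open {x \<in> win (snd i). sec i x \<in> topspace T - {p \<in> topspace T. proj (f p) = proj p}}"
    (is "open ?W") unfolding openin_T by blast
  moreover have "proj p \<in> ?W" using ne p i by simp
  ultimately obtain n t where n: "1 \<le> n" "\<bar>t\<bar> < real n" "y n + t *\<^sub>R a \<in> ?W"
    using y_segments_dense by blast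
  then show False using vf_auts_proj_y[OF f n(1) i(1) n(2)] i(1) by auto
qed

text \<open>The label of the image of the base point \<open>pt \<one> u\<close> determines
  \<open>h\<close>; uniqueness of lifts does the rest.\<close>

lemma vf_auts_eq_L:
  assumes f: "f \<in> vf_auts M (const_field a)" and u: "0 < b \<bullet> u" "\<And>k. u \<in> win k"
  shows "\<exists>h\<in>carrier G. f = L h"
proof -
  have q: "pt \<one> u \<in> topspace T" using pt_topspace u by blast
  have cont: "continuous_map T T f"
    using vf_auts_preserves[OF f] by (simp add: preserves_def smooth_map_continuous)
  have "f (pt \<one> u) \<in> topspace T" by (rule funcset_mem[OF continuous_map_funspace[OF cont] q])
  then obtain h x k where h: "h \<in> carrier G" "f (pt \<one> u) = pt h x" using obtain_pt by metis
  then have "x = u" using vf_auts_proj[OF f q] by simp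
  then have eq: "f (pt \<one> u) = L h (pt \<one> u)" using h L_pt[of \<one> \<one> u h] u by simp
  have "f p = L h p" if "p \<in> topspace T" for p
    using that
  proof (rule lift_unique[OF connected_T cont continuous_map_deck[OF deck_L[OF h(1)]] _ q eq, rotated])
    show "proj (f p) = proj (L h p)" if "p \<in> topspace T" for p
      using vf_auts_proj[OF f that] pr_deck[OF deck_L[OF h(1)] that] by simp
  qed
  moreover have "f \<in> extensional (topspace T)" "L h \<in> extensional (topspace T)"
    using f by (auto simp: vf_auts_def diffeos_def Bij_def L_def)
  ultimately have "f = L h" by (metis extensionalityI)
  then show ?thesis using h by blast
qed

lemma pi0_Aut_iso: "pi0_Aut M (const_field a) \<cong> G"
proof -
  let ?A = "vf_auts M (const_field a)"
  obtain u where u: "0 < b \<bullet> u" "\<And>k. u \<in> win k" using ex_up by blast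
  have A: "?A = L ` carrier G"
  proof (intro equalityI subsetI)
    fix f assume "f \<in> ?A"
    from vf_auts_eq_L[OF this u] show "f \<in> L ` carrier G" by (elim bexE) simp
  next
    fix f assume "f \<in> L ` carrier G"
    then obtain h where "h \<in> carrier G" "f = L h" by (elim imageE)
    then show "f \<in> ?A" by (simp add: L_vf_auts)
  qed
  have q: "pt \<one> u \<in> topspace T" using pt_topspace u by blast
  have Lq: "L h (pt \<one> u) = pt h u" if "h \<in> carrier G" for h
    using that L_pt[of \<one> \<one> u h] u by simp
  \<comment> \<open>The sheets over one window separate the labels over \<open>u\<close>, which
    gives the isolating neighbourhoods of the automorphisms.\<close>
  have inU: "pt h u \<in> U (h', \<one>) \<longleftrightarrow> h = h'" if h: "h \<in> carrier G" "h' \<in> carrier G" for h h'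
  proof
    assume "pt h u \<in> U (h', \<one>)"
    then have "sec (h', \<one>) (proj (pt h u)) = pt h u" using h by (intro s_pr) auto
    then show "h = h'" using h u by (simp add: sec_def inj_pt)
  next
    assume "h = h'"
    then show "pt h u \<in> U (h', \<one>)"
      using s_in_U[of u "(h', \<one>)"] u by (simp add: sec_def)
  qed
  have top: "Aut_topology M (const_field a) = discrete_topology ?A"
  proof (rule Aut_topology_discrete)
    fix f assume "f \<in> ?A"
    then obtain h where h: "h \<in> carrier G" "f = L h" using A by blast
    have "\<forall>g\<in>?A. g (pt \<one> u) \<in> U (h, \<one>) \<longrightarrow> g = f"
      unfolding A using h Lq inU by auto
    moreover have "f (pt \<one> u) \<in> U (h, \<one>)" using h Lq inU by simp
    ultimately show "\<exists>p\<in>topspace T. \<exists>k\<in>carrier G \<times> carrier G. f p \<in> U k \<and>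
        (\<forall>g\<in>?A. g p \<in> U k \<longrightarrow> g = f)"
      using q h by (intro bexI[OF _ q] bexI[of _ "(h, \<one>)"]) auto
  qed
  have mult: "L g \<otimes>\<^bsub>Aut_group M (const_field a)\<^esub> L h = L (g \<otimes> h)"
    if "g \<in> carrier G" "h \<in> carrier G" for g h
  proof -
    have "L g \<otimes>\<^bsub>Aut_group M (const_field a)\<^esub> L h = compose (topspace T) (L g) (L h)"
      using that by (simp add: Aut_group_def BijGroup_def L_Bij)
    also have "\<dots> = L (g \<otimes> h)"
    proof
      show "compose (topspace T) (L g) (L h) p = L (g \<otimes> h) p" for p
        using that by (cases "p \<in> topspace T") (auto simp: compose_def L_L, simp add: L_def)
    qed
    finally show ?thesis .
  qed
  have carrier: "carrier (Aut_group M (const_field a)) = ?A" by (simp add: Aut_group_def)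
  have "inj_on L (carrier G)"
  proof (rule inj_onI)
    fix g h assume "g \<in> carrier G" "h \<in> carrier G" "L g = L h"
    then show "g = h" using Lq inj_pt by metis
  qed
  then have "L \<in> iso G (Aut_group M (const_field a))"
    using A mult by (intro isoI homI) (auto simp: carrier bij_betw_def)
  moreover have "(\<lambda>f. {f}) \<in> iso (Aut_group M (const_field a)) (pi0_Aut M (const_field a))"
    unfolding pi0_Aut_def top carrier[symmetric]
    by (rule pi0_group_discrete_iso) (use A mult in \<open>auto simp: carrier\<close>)
  \<comment> \<open>The isomorphism is built starting from \<open>G\<close>, whose group laws are at
    hand, and is reversed at the end.\<close>
  ultimately have "G \<cong> pi0_Aut M (const_field a)"
    using iso_set_trans is_isoI by blast
  then show ?thesis by (rule iso_sym)
qed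

end

text \<open>A countable dense set of the whole space, without its points orthogonal to
  \<open>b\<close>, is projected to the hyperplane. The image meets each relevant open set
  infinitely often, so an injective enumeration visits it at arbitrarily large indices.\<close>

lemma ex_dense_sequence_in_hyperplane:
  fixes a b :: "'e::euclidean_space"
  assumes "a \<in> Basis" "b \<in> Basis" "a \<noteq> b"
  obtains y :: "nat \<Rightarrow> 'e" where "inj y" "\<And>n. a \<bullet> y n = 0" "\<And>n. b \<bullet> y n \<noteq> 0"
    "\<And>W x N. open W \<Longrightarrow> x \<in> W \<Longrightarrow> a \<bullet> x = 0 \<Longrightarrow> \<exists>n>N. y n \<in> W"
proof -
  have [simp]: "a \<bullet> a = 1" "b \<bullet> b = 1" "a \<bullet> b = 0" "b \<bullet> a = 0" "b \<noteq> 0"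
    using assms by (auto simp: inner_Basis)
  obtain D :: "'e set" where D: "countable D" "\<And>W. open W \<Longrightarrow> W \<noteq> {} \<Longrightarrow> \<exists>d\<in>D. d \<in> W"
    using countable_dense_exists by metis
  define h where "h v = v - (a \<bullet> v) *\<^sub>R a" for v
  define Q where "Q = h ` {d \<in> D. b \<bullet> d \<noteq> 0}"
  have count: "countable Q" using D(1) by (simp add: Q_def)
  have inf: "infinite (Q \<inter> W)" if W: "open W" "x \<in> W" "a \<bullet> x = 0" for W x
  proof
    assume fin: "finite (Q \<inter> W)"
    obtain e where e: "0 < e" "ball x e \<subseteq> W" using W open_contains_ball by blast
    have inj: "inj (\<lambda>t. x + t *\<^sub>R b)" by (auto intro: injI)
    \<comment> \<open>On the line through \<open>x\<close> of direction \<open>b\<close> only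
      finitely many points are in \<open>Q \<inter> W\<close> or orthogonal to \<open>b\<close>, so
      a point near \<open>x\<close> avoids both. A point of \<open>D\<close> projecting close to it
      would land both inside and outside \<open>Q \<inter> W\<close>.\<close>
    have "finite ((\<lambda>t. x + t *\<^sub>R b) -` (Q \<inter> W) \<union> {- (b \<bullet> x)})"
      using finite_vimageI[OF fin inj] by simp
    moreover have "infinite {0<..<e}" using e by simp
    ultimately obtain t where t: "t \<in> {0<..<e}" "x + t *\<^sub>R b \<notin> Q \<inter> W" "t \<noteq> - (b \<bullet> x)"
      using Diff_infinite_finite[of _ "{0<..<e}"] infinite_imp_nonempty by blast
    let ?v = "x + t *\<^sub>R b"
    let ?W = "h -` (W - Q \<inter> W) \<inter> {v. b \<bullet> v \<noteq> 0}"
    have "open (W - Q \<inter> W)" using W fin by (intro open_Diff finite_imp_closed)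
    then have "open (h -` (W - Q \<inter> W))"
    proof (rule continuous_open_vimage)
      show "isCont h v" for v unfolding h_def by (intro continuous_intros)
    qed
    moreover have "open {v. b \<bullet> v \<noteq> 0}" by (intro open_Collect_neq continuous_intros)
    ultimately have "open ?W" by (rule open_Int)
    moreover have "?v \<in> ball x e" using t norm_Basis[OF assms(2)] by (simp add: dist_norm)
    then have "?v \<in> W" using e by blast
    then have "?v \<in> ?W" using t W by (auto simp: h_def inner_add_right)
    ultimately obtain d where d: "d \<in> D" "d \<in> ?W" using D(2)[of ?W] by blast
    then have "h d \<in> Q" "h d \<in> W - Q \<inter> W" by (auto simp: Q_def)
    then show False by blast
  qed
  have "infinite Q" using inf[of UNIV 0] by simp
  then have bij: "bij_betw (from_nat_into Q) UNIV Q" using count by (rule bij_betw_from_nat_into[rotated])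
  show ?thesis
  proof (rule that)
    show "inj (from_nat_into Q)" using bij by (simp add: bij_betw_def)
    have mem: "from_nat_into Q n \<in> Q" for n using bij by (auto simp: bij_betw_def)
    have Q: "a \<bullet> q = 0 \<and> b \<bullet> q \<noteq> 0" if "q \<in> Q" for q
      using that by (auto simp: Q_def h_def inner_diff_right)
    show "a \<bullet> from_nat_into Q n = 0" "b \<bullet> from_nat_into Q n \<noteq> 0" for n using Q[OF mem] by auto
    fix W x N assume W: "open W" "x \<in> W" "a \<bullet> x = 0"
    have "from_nat_into Q ` {n. from_nat_into Q n \<in> W} = Q \<inter> W"
      using bij by (auto simp: bij_betw_def)
    then have "infinite {n. from_nat_into Q n \<in> W}" using inf[OF W] by (metis finite_imageI)
    then show "\<exists>n>N. from_nat_into Q n \<in> W" unfolding infinite_nat_iff_unbounded by blast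
  qed
qed

theorem corollary1:
  fixes G :: "('g, 'b) monoid_scheme" and m :: nat
  assumes "group G" and "finite (carrier G)"
    and "m \<ge> 2" and "CARD('m::finite) = m"
  shows "\<exists>(M :: (point, real ^ 'm) smooth_space) X.
           smooth_manifold M \<and> connected_space (mtop M) \<and> mpoints M \<noteq> {} \<and>
           smooth_vector_field M X \<and> pi0_Aut M X \<cong> G"
proof -
  have "2 \<le> card (Basis :: (real ^ 'm) set)" using assms(3,4) by simp
  then obtain B :: "(real ^ 'm) set" where "B \<subseteq> Basis" "card B = 2"
    using obtain_subset_with_card_n by metis
  then obtain a b :: "real ^ 'm" where ab: "a \<in> Basis" "b \<in> Basis" "a \<noteq> b"
    unfolding card_2_iff by blast
  obtain y :: "nat \<Rightarrow> real ^ 'm" where y: "inj y" "\<And>n. a \<bullet> y n = 0" "\<And>n. b \<bullet> y n \<noteq> 0"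
    "\<And>W x N. open W \<Longrightarrow> x \<in> W \<Longrightarrow> a \<bullet> x = 0 \<Longrightarrow> \<exists>n>N. y n \<in> W"
    using ex_dense_sequence_in_hyperplane[OF ab] by metis
  obtain idx :: "'g \<Rightarrow> nat" where idx: "inj_on idx (carrier G)"
    using finite_imp_inj_to_nat_seg[OF assms(2)] by blast
  obtain c :: "'m \<Rightarrow> nat" where c: "inj c"
    using finite_imp_inj_to_nat_seg[of "UNIV :: 'm set"] by auto
  \<comment> \<open>The label is stored at index 0, and the coordinate \<open>i\<close> of
    \<open>x\<close> at index \<open>Suc (c i)\<close>.\<close>
  define pt :: "'g \<Rightarrow> real ^ 'm \<Rightarrow> point" where
    "pt g x = case_nat (real (idx g)) (\<lambda>k. x $ inv_into UNIV c k)" for g x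
  have pt: "pt g x = pt h x' \<longleftrightarrow> g = h \<and> x = x'" if gh: "g \<in> carrier G" "h \<in> carrier G" for g h x x'
  proof
    assume eq: "pt g x = pt h x'"
    have "idx g = idx h" using fun_cong[OF eq, of 0] by (simp add: pt_def)
    moreover have "x $ i = x' $ i" for i
      using fun_cong[OF eq, of "Suc (c i)"] c by (simp add: pt_def)
    ultimately show "g = h \<and> x = x'" using gh inj_onD[OF idx] by (simp add: vec_eq_iff)
  qed simp
  interpret group G by fact
  interpret slit_cover G a b idx y pt
    using assms(2) ab idx y pt by unfold_locales auto
  obtain x where "x \<in> win \<one>\<^bsub>G\<^esub>" using ex_up by blast
  then have "pt \<one>\<^bsub>G\<^esub> x \<in> mpoints M" by (simp add: pt_topspace[OF one_closed one_closed])
  then have "mpoints M \<noteq> {}" by blast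
  then show ?thesis
    using smooth_manifold_M connected_T smooth_vector_field_const_field[of a] pi0_Aut_iso
    by (intro exI[of _ M] exI[of _ "const_field a"]) simp
qed

end
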